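(* Let $p>1$ be a real number and let $\Gamma$ be a finitely generated infinite group. Then $\bar H^1_{(p)}(\Gamma)\neq 0$ if and only if $\#(\partial_p(\Gamma))>1$.
   Context: Fix a finite generating set $S$ of $\Gamma$. The Cayley graph of $\Gamma$ has vertex set $V=\Gamma$, and distinct $x_1,x_2\in\Gamma$ are joined by an edge iff $x_1=x_2s^{\pm1}$ for some $s\in S$. All spaces below are those of this graph; $\partial_p(\Gamma)$ denotes its $p$-harmonic boundary. Let $N_x$ be the set of neighbors of $x\in\Gamma$ and $e$ the identity. For $f\colon\Gamma\to\mathbb{R}$ put $I_p(f,\Gamma)=\sum_{x\in\Gamma}\sum_{y\in N_x}|f(y)-f(x)|^p$. $D_p(\Gamma)=\{f\colon\Gamma\to\mathbb{R}\mid I_p(f,\Gamma)<\infty\}$ with norm $\|f\|_{D_p}=(I_p(f,\Gamma)+|f(e)|^p)^{1/p}$. $\ell^p(\Gamma)$ is the set of $f\colon\Gamma\to\mathbb{R}$ with $\sum_{x\in\Gamma}|f(x)|^p<\infty$, and $\mathbb{R}$ is identified with the constant functions. The first reduced $\ell^p$-cohomology space is $\bar H^1_{(p)}(\Gamma)=D_p(\Gamma)/(\overline{\ell^p(\Gamma)\oplus\mathbb{R}})_{D_p}$, the closure being in $D_p(\Gamma)$. $\ell^\infty(\Gamma)$ is the set of bounded real functions on $\Gamma$, and $BD_p(\Gamma)=D_p(\Gamma)\cap\ell^\infty(\Gamma)$, a commutative Banach algebra under pointwise multiplication with norm $\|f\|_{BD_p}=I_p(f,\Gamma)^{1/p}+\sup_\Gamma|f|$.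 $\mathbb{R}\Gamma$ is the set of finitely supported real functions on $\Gamma$, and $B(\overline{\mathbb{R}\Gamma})_{D_p}$ is the set of bounded functions in the closure of $\mathbb{R}\Gamma$ in $D_p(\Gamma)$. $Sp(BD_p(\Gamma))$ is the set of nonzero algebra homomorphisms $BD_p(\Gamma)\to\mathbb{C}$ with the weak-$*$ topology; for $f\in BD_p(\Gamma)$, $\hat f(\tau)=\tau(f)$; $\Gamma$ is identified with its image in $Sp(BD_p(\Gamma))$ under $x\mapsto(f\mapsto f(x))$. Then $R_p(\Gamma)=Sp(BD_p(\Gamma))\setminus\Gamma$ and $\partial_p(\Gamma)=\{x\in R_p(\Gamma)\mid\hat f(x)=0\text{ for all }f\in B(\overline{\mathbb{R}\Gamma})_{D_p}\}$. *)

theory Defs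
  imports Complex_Main "HOL-Library.FuncSet" "HOL-Algebra.Generated_Groups"
    "HOL-Analysis.Infinite_Sum"
begin

text \<open>A real function on the group \<open>G\<close> is represented by its extension by zero outside
  \<open>carrier G\<close>. This makes the representation unique and, unlike extensionality in the sense
  of \<open>FuncSet\<close>, is preserved by the pointwise operations of \<open>'a \<Rightarrow> real\<close>.\<close>

definition group_funs :: "('a, 'b) monoid_scheme \<Rightarrow> ('a \<Rightarrow> real) set" where
  "group_funs G = {f. \<forall>x. x \<notin> carrier G \<longrightarrow> f x = 0}"

definition const_fun :: "('a, 'b) monoid_scheme \<Rightarrow> real \<Rightarrow> 'a \<Rightarrow> real" where
  "const_fun G c = (\<lambda>x. if x \<in> carrier G then c else 0)"

definition cayley_nbrs :: "('a, 'b) monoid_scheme \<Rightarrow> 'a set \<Rightarrow> 'a \<Rightarrow> 'a set" where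
  "cayley_nbrs G S x =
    {y \<in> carrier G. y \<noteq> x \<and> (\<exists>s\<in>S. x = y \<otimes>\<^bsub>G\<^esub> s \<or> x = y \<otimes>\<^bsub>G\<^esub> inv\<^bsub>G\<^esub> s)}"

definition grad_pow :: "('a, 'b) monoid_scheme \<Rightarrow> 'a set \<Rightarrow> real \<Rightarrow> ('a \<Rightarrow> real) \<Rightarrow> 'a \<Rightarrow> real" where
  "grad_pow G S p f x = (\<Sum>y\<in>cayley_nbrs G S x. \<bar>f y - f x\<bar> powr p)"

text \<open>The value of \<open>infsum\<close> is meaningful only for summable families, so finiteness of the
  \<open>p\<close>-energy is expressed by \<open>summable_on\<close> in \<open>Dp\<close>.\<close>

definition Ip :: "('a, 'b) monoid_scheme \<Rightarrow> 'a set \<Rightarrow> real \<Rightarrow> ('a \<Rightarrow> real) \<Rightarrow> real" where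
  "Ip G S p f = infsum (grad_pow G S p f) (carrier G)"

definition Dp :: "('a, 'b) monoid_scheme \<Rightarrow> 'a set \<Rightarrow> real \<Rightarrow> ('a \<Rightarrow> real) set" where
  "Dp G S p = {f \<in> group_funs G. grad_pow G S p f summable_on carrier G}"

definition Dp_norm :: "('a, 'b) monoid_scheme \<Rightarrow> 'a set \<Rightarrow> real \<Rightarrow> ('a \<Rightarrow> real) \<Rightarrow> real" where
  "Dp_norm G S p f = (Ip G S p f + \<bar>f \<one>\<^bsub>G\<^esub>\<bar> powr p) powr (1 / p)"

definition Dp_closure ::
  "('a, 'b) monoid_scheme \<Rightarrow> 'a set \<Rightarrow> real \<Rightarrow> ('a \<Rightarrow> real) set \<Rightarrow> ('a \<Rightarrow> real) set" where
  "Dp_closure G S p A =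
    {f \<in> Dp G S p. \<forall>\<epsilon>>0. \<exists>g\<in>A \<inter> Dp G S p. Dp_norm G S p (\<lambda>x. f x - g x) < \<epsilon>}"

definition ellp :: "('a, 'b) monoid_scheme \<Rightarrow> real \<Rightarrow> ('a \<Rightarrow> real) set" where
  "ellp G p = {f \<in> group_funs G. (\<lambda>x. \<bar>f x\<bar> powr p) summable_on carrier G}"

definition ellp_plus_const :: "('a, 'b) monoid_scheme \<Rightarrow> real \<Rightarrow> ('a \<Rightarrow> real) set" where
  "ellp_plus_const G p = {(\<lambda>x. f x + const_fun G c x) | f c. f \<in> ellp G p}"

text \<open>The quotient space is the set of classes of \<open>Dp\<close> modulo the closed subspace;
  its zero vector is the class of the zero function.\<close>

definition H1_rel ::
  "('a, 'b) monoid_scheme \<Rightarrow> 'a set \<Rightarrow> real \<Rightarrow> (('a \<Rightarrow> real) \<times> ('a \<Rightarrow> real)) set" where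
  "H1_rel G S p = {(f, g). f \<in> Dp G S p \<and> g \<in> Dp G S p \<and>
     (\<lambda>x. f x - g x) \<in> Dp_closure G S p (ellp_plus_const G p)}"

definition reduced_H1 ::
  "('a, 'b) monoid_scheme \<Rightarrow> 'a set \<Rightarrow> real \<Rightarrow> ('a \<Rightarrow> real) set set" where
  "reduced_H1 G S p = Dp G S p // H1_rel G S p"

definition reduced_H1_zero ::
  "('a, 'b) monoid_scheme \<Rightarrow> 'a set \<Rightarrow> real \<Rightarrow> ('a \<Rightarrow> real) set" where
  "reduced_H1_zero G S p = H1_rel G S p `` {\<lambda>x. 0}"

definition ellinf :: "('a, 'b) monoid_scheme \<Rightarrow> ('a \<Rightarrow> real) set" where
  "ellinf G = {f \<in> group_funs G. \<exists>C. \<forall>x\<in>carrier G. \<bar>f x\<bar> \<le> C}"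

definition BDp :: "('a, 'b) monoid_scheme \<Rightarrow> 'a set \<Rightarrow> real \<Rightarrow> ('a \<Rightarrow> real) set" where
  "BDp G S p = Dp G S p \<inter> ellinf G"

definition finsupp_funs :: "('a, 'b) monoid_scheme \<Rightarrow> ('a \<Rightarrow> real) set" where
  "finsupp_funs G = {f \<in> group_funs G. finite {x \<in> carrier G. f x \<noteq> 0}}"

definition B_closure_finsupp ::
  "('a, 'b) monoid_scheme \<Rightarrow> 'a set \<Rightarrow> real \<Rightarrow> ('a \<Rightarrow> real) set" where
  "B_closure_finsupp G S p = Dp_closure G S p (finsupp_funs G) \<inter> ellinf G"

text \<open>\<open>BDp\<close> is a real algebra, so its algebra homomorphisms into \<open>\<complex>\<close> are the real-linear
  multiplicative maps. Extensionality makes two of them equal as soon as they agree on \<open>BDp\<close>.\<close>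

definition Sp_BDp ::
  "('a, 'b) monoid_scheme \<Rightarrow> 'a set \<Rightarrow> real \<Rightarrow> (('a \<Rightarrow> real) \<Rightarrow> complex) set" where
  "Sp_BDp G S p = {\<tau> \<in> extensional (BDp G S p).
     (\<forall>f\<in>BDp G S p. \<forall>g\<in>BDp G S p. \<tau> (\<lambda>x. f x + g x) = \<tau> f + \<tau> g) \<and>
     (\<forall>c. \<forall>f\<in>BDp G S p. \<tau> (\<lambda>x. c * f x) = complex_of_real c * \<tau> f) \<and>
     (\<forall>f\<in>BDp G S p. \<forall>g\<in>BDp G S p. \<tau> (\<lambda>x. f x * g x) = \<tau> f * \<tau> g) \<and>
     (\<exists>f\<in>BDp G S p. \<tau> f \<noteq> 0)}"

definition point_eval ::
  "('a, 'b) monoid_scheme \<Rightarrow> 'a set \<Rightarrow> real \<Rightarrow> 'a \<Rightarrow> ('a \<Rightarrow> real) \<Rightarrow> complex" where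
  "point_eval G S p x = (\<lambda>f\<in>BDp G S p. complex_of_real (f x))"

definition Rp ::
  "('a, 'b) monoid_scheme \<Rightarrow> 'a set \<Rightarrow> real \<Rightarrow> (('a \<Rightarrow> real) \<Rightarrow> complex) set" where
  "Rp G S p = Sp_BDp G S p - point_eval G S p ` carrier G"

text \<open>The \<open>p\<close>-harmonic boundary as a set; the weak-\<open>*\<close> topology on \<open>Sp_BDp\<close> does not enter
  its definition.\<close>

definition harmonic_boundary ::
  "('a, 'b) monoid_scheme \<Rightarrow> 'a set \<Rightarrow> real \<Rightarrow> (('a \<Rightarrow> real) \<Rightarrow> complex) set" where
  "harmonic_boundary G S p = {\<tau> \<in> Rp G S p. \<forall>f\<in>B_closure_finsupp G S p. \<tau> f = 0}"

end

theory Submission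
  imports Defs "HOL-Analysis.Function_Topology"
begin

text \<open>
  Write \<open>D\<close> for the functions of finite \<open>p\<close>-energy, \<open>BD\<close> for the bounded ones, \<open>D0\<close> for the
  closure of the finitely supported functions and \<open>B0\<close> for its bounded elements. A boundary
  point is a character of \<open>BD\<close> that annihilates \<open>B0\<close>, so the harmonic boundary is the spectrum
  of the quotient of \<open>BD\<close> by \<open>B0\<close>, where \<open>B0\<close> is an ideal (\<open>B0_mult\<close>). On the other side,
  \<open>p\<close>-summable functions of finite energy lie in \<open>D0\<close> (\<open>ellp_subset_D0\<close>) and bounded functions
  are dense in \<open>D\<close> (\<open>tendsto_clamp_large\<close>). Both sides thus ask the same question: is every
  bounded function of finite energy constant modulo \<open>D0\<close>?

  If the cohomology vanishes, every function in \<open>D\<close> is a limit of functions \<open>g n + c n\<close> with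
  \<open>g n\<close> in \<open>D0\<close> and \<open>c n\<close> constant. When a boundary point exists, \<open>1\<close> is not in \<open>D0\<close>, so the
  constants converge (\<open>constant_modulo_D0\<close>) and each bounded function is a constant modulo \<open>B0\<close>.
  All boundary points take that constant as value, hence they coincide
  (\<open>boundary_point_unique\<close>).

  If the cohomology does not vanish, some bounded \<open>h\<close> is not constant modulo \<open>D0\<close>. Boundary
  points are obtained as cluster points of evaluations at group elements along filters on which
  every element of \<open>B0\<close> becomes small (\<open>exists_boundary_point\<close>). If \<open>h\<close> took at most one value
  on the boundary, compactness would make \<open>h\<close> uniformly close to that value wherever a suitable
  element of \<open>B0\<close> is small. Since a function that vanishes where an element of \<open>B0\<close> is small
  belongs to \<open>B0\<close> (\<open>B0_of_vanishing\<close>), soft thresholding would exhibit \<open>h\<close> minus its value as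
  a limit of elements of \<open>B0\<close>, a contradiction (\<open>two_boundary_points\<close>).

  The analytic input is dominated convergence for the gradients of truncated functions
  (\<open>tendsto_energy_dominated\<close>). In the parabolic case, where \<open>1\<close> lies in \<open>D0\<close>, the boundary is
  empty because characters map \<open>1\<close> to \<open>1\<close>, and the cohomology vanishes because the ideal
  \<open>B0\<close> is all of \<open>BD\<close>.
\<close>

section \<open>Dominated convergence for unordered sums\<close>

lemma powr_add_le:
  fixes a b p :: real
  assumes "p \<ge> 0"
  shows "\<bar>a + b\<bar> powr p \<le> 2 powr p * (\<bar>a\<bar> powr p + \<bar>b\<bar> powr p)"
proof -
  let ?m = "max \<bar>a\<bar> \<bar>b\<bar>"
  have "\<bar>a + b\<bar> powr p \<le> (2 * ?m) powr p"
    using assms by (intro powr_mono2) auto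
  also have "\<dots> = 2 powr p * ?m powr p"
    by (simp add: powr_mult)
  also have "\<dots> \<le> 2 powr p * (\<bar>a\<bar> powr p + \<bar>b\<bar> powr p)"
    by (intro mult_left_mono) (auto simp: max_def)
  finally show ?thesis .
qed

lemma tendsto_powr_zero:
  fixes f :: "nat \<Rightarrow> real"
  assumes "f \<longlonglongrightarrow> 0" "q > 0"
  shows "(\<lambda>n. \<bar>f n\<bar> powr q) \<longlonglongrightarrow> 0"
proof -
  have "(\<lambda>n. \<bar>f n\<bar>) \<longlonglongrightarrow> 0"
    using assms(1) by (simp add: tendsto_rabs_zero)
  then have "(\<lambda>n. \<bar>f n\<bar> powr q) \<longlonglongrightarrow> 0 powr q"
    using assms(2) by (intro tendsto_powr') auto
  then show ?thesis by simp
qed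

lemma tendsto_zero_from_powr:
  fixes f :: "nat \<Rightarrow> real"
  assumes "(\<lambda>n. \<bar>f n\<bar> powr q) \<longlonglongrightarrow> 0" "q > 0"
  shows "f \<longlonglongrightarrow> 0"
proof -
  have "(\<lambda>n. \<bar>\<bar>f n\<bar> powr q\<bar> powr (1 / q)) \<longlonglongrightarrow> 0"
    using assms(2) by (intro tendsto_powr_zero[OF assms(1)]) simp
  moreover have "\<bar>\<bar>f n\<bar> powr q\<bar> powr (1 / q) = \<bar>f n\<bar>" for n
    using assms(2) by (simp add: powr_powr)
  ultimately have "(\<lambda>n. \<bar>f n\<bar>) \<longlonglongrightarrow> 0" by (simp only:)
  then show ?thesis by (rule tendsto_rabs_zero_cancel)
qed

text \<open>Outside a finite set the sum of the bound \<open>w\<close> is small, and on the finite set the limit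
  may be taken termwise.\<close>
lemma infsum_tendsto_zero_dominated:
  fixes a :: "nat \<Rightarrow> 'i \<Rightarrow> real"
  assumes nonneg: "\<And>n x. x \<in> A \<Longrightarrow> 0 \<le> a n x"
    and lim: "\<And>x. x \<in> A \<Longrightarrow> (\<lambda>n. a n x) \<longlonglongrightarrow> 0"
    and dom: "\<And>n x. x \<in> A \<Longrightarrow> a n x \<le> w x"
    and w: "w summable_on A"
  shows "(\<lambda>n. infsum (a n) A) \<longlonglongrightarrow> 0"
proof (rule LIMSEQ_I)
  fix r :: real assume r: "r > 0"
  have w0: "0 \<le> w x" if "x \<in> A" for x
    using nonneg[OF that, of 0] dom[OF that, of 0] by linarith
  have sa: "a n summable_on A" for n
    by (rule summable_on_comparison_test[OF w]) (auto simp: nonneg dom)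
  have "(w has_sum infsum w A) A" using w by simp
  then have "eventually (\<lambda>F. dist (sum w F) (infsum w A) < r / 2) (finite_subsets_at_top A)"
    unfolding has_sum_def using r by (intro tendstoD) auto
  then obtain F where F: "finite F" "F \<subseteq> A" "dist (sum w F) (infsum w A) < r / 2"
    unfolding eventually_finite_subsets_at_top by blast
  have sw: "w summable_on (A - F)" by (rule summable_on_subset_banach[OF w]) auto
  have "infsum w A = infsum w F + infsum w (A - F)"
    using infsum_Un_disjoint[of w F "A - F"] F sw by (auto simp: Un_absorb1)
  then have tail: "infsum w (A - F) < r / 2"
    using F by (simp add: dist_real_def)
  have "(\<lambda>n. \<Sum>x\<in>F. a n x) \<longlonglongrightarrow> (\<Sum>x\<in>F. 0)"
    using F lim by (intro tendsto_sum) auto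
  then have "eventually (\<lambda>n. (\<Sum>x\<in>F. a n x) < r / 2) sequentially"
    using r by (intro order_tendstoD(2)) auto
  then obtain N where N: "\<And>n. n \<ge> N \<Longrightarrow> (\<Sum>x\<in>F. a n x) < r / 2"
    unfolding eventually_sequentially by blast
  have "norm (infsum (a n) A - 0) < r" if "n \<ge> N" for n
  proof -
    have "infsum (a n) A = infsum (a n) F + infsum (a n) (A - F)"
      using infsum_Un_disjoint[of "a n" F "A - F"] F sa[of n]
      by (auto simp: Un_absorb1 intro: summable_on_subset_banach)
    also have "infsum (a n) (A - F) \<le> infsum w (A - F)"
      by (rule infsum_mono) (auto intro: summable_on_subset_banach[OF sa] sw dom)
    finally have "infsum (a n) A < r" using N[OF that] tail F by simp
    moreover have "infsum (a n) A \<ge> 0" by (intro infsum_nonneg nonneg)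
    ultimately show ?thesis by simp
  qed
  then show "\<exists>N. \<forall>n\<ge>N. norm (infsum (a n) A - 0) < r" by blast
qed

text \<open>Truncations of approximating functions are not dominated by one fixed summable function,
  only up to an error that depends on the index but tends to zero in sum. Such an error is
  harmless: \<open>min (a n) w\<close> is dominated by \<open>w\<close>, and it differs from \<open>a n\<close> by at most \<open>b n\<close>.\<close>
lemma infsum_tendsto_zero_almost_dominated:
  fixes a b :: "nat \<Rightarrow> 'i \<Rightarrow> real"
  assumes nonneg: "\<And>n x. x \<in> A \<Longrightarrow> 0 \<le> a n x" "\<And>n x. x \<in> A \<Longrightarrow> 0 \<le> b n x"
    and lim: "\<And>x. x \<in> A \<Longrightarrow> (\<lambda>n. a n x) \<longlonglongrightarrow> 0"
    and dom: "\<And>n x. x \<in> A \<Longrightarrow> a n x \<le> w x + b n x"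
    and w: "w summable_on A" "\<And>x. x \<in> A \<Longrightarrow> 0 \<le> w x"
    and b: "\<And>n. b n summable_on A" "(\<lambda>n. infsum (b n) A) \<longlonglongrightarrow> 0"
  shows "(\<lambda>n. infsum (a n) A) \<longlonglongrightarrow> 0"
proof -
  let ?m = "\<lambda>n x. min (a n x) (w x)"
  have m0: "0 \<le> ?m n x" if "x \<in> A" for n x using nonneg w that by auto
  have mlim: "(\<lambda>n. ?m n x) \<longlonglongrightarrow> 0" if "x \<in> A" for x
    by (rule tendsto_sandwich[OF _ _ tendsto_const lim[OF that]]) (auto simp: m0 that nonneg w)
  have sm: "?m n summable_on A" for n
    by (rule summable_on_comparison_test[OF w(1)]) (use m0 in auto)
  have am: "a n x \<le> ?m n x + b n x" if "x \<in> A" for n x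
    using dom[OF that, of n] nonneg[OF that, of n] by (auto simp: min_def)
  have sa: "a n summable_on A" for n
    by (rule summable_on_comparison_test[OF summable_on_add[OF sm b(1)]]) (use am nonneg in auto)
  have "(\<lambda>n. infsum (?m n) A) \<longlonglongrightarrow> 0"
    by (rule infsum_tendsto_zero_dominated[where w = w]) (use m0 mlim w in auto)
  then have lim0: "(\<lambda>n. infsum (?m n) A + infsum (b n) A) \<longlonglongrightarrow> 0"
    using tendsto_add[OF _ b(2)] by fastforce
  have le: "infsum (a n) A \<le> infsum (?m n) A + infsum (b n) A" for n
    unfolding infsum_add[OF sm b(1), symmetric]
    by (rule infsum_mono[OF sa summable_on_add[OF sm b(1)] am])
  show ?thesis
    by (rule tendsto_sandwich[OF _ _ tendsto_const lim0])
      (auto intro!: always_eventually infsum_nonneg nonneg le)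
qed

section \<open>The energy of functions on a Cayley graph\<close>

locale cayley_graph = group G for G :: "('a, 'b) monoid_scheme" (structure) +
  fixes S :: "'a set" and p :: real
  assumes p: "p > 1"
    and finite_S: "finite S" and S_carrier: "S \<subseteq> carrier G"
    and generates: "generate G S = carrier G"
begin

abbreviation "nbrs \<equiv> cayley_nbrs G S"
abbreviation "E \<equiv> grad_pow G S p"
abbreviation "D \<equiv> Dp G S p"
abbreviation "BD \<equiv> BDp G S p"
abbreviation "cst \<equiv> const_fun G"
abbreviation "cl \<equiv> Dp_closure G S p"

text \<open>The \<open>p\<close>-th power of the norm on \<open>D\<close>. It satisfies the triangle inequality
  only up to the factor \<open>2 powr p\<close>, which is harmless in limit arguments, and pointwise
  estimates of gradients can be summed over the vertices without taking roots.\<close>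
definition energy :: "('a \<Rightarrow> real) \<Rightarrow> real" where
  "energy f = Ip G S p f + \<bar>f \<one>\<bar> powr p"

lemma p_pos [simp]: "p > 0" "p \<ge> 0" "p \<noteq> 0" using p by auto

lemma nbrs_carrier: "y \<in> nbrs x \<Longrightarrow> y \<in> carrier G"
  by (simp add: cayley_nbrs_def)

lemma finite_nbrs: 
  assumes "x \<in> carrier G"
  shows "finite (nbrs x)"
proof (rule finite_subset)
  show "nbrs x \<subseteq> (\<lambda>s. x \<otimes> inv s) ` S \<union> (\<lambda>s. x \<otimes> s) ` S"
  proof
    fix y assume "y \<in> nbrs x"
    then obtain s where s: "s \<in> S" "y \<in> carrier G" "x = y \<otimes> s \<or> x = y \<otimes> inv s"
      by (auto simp: cayley_nbrs_def)
    moreover have "s \<in> carrier G" using s S_carrier by auto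
    ultimately have "y = x \<otimes> inv s \<or> y = x \<otimes> s"
      by (auto simp: m_assoc)
    then show "y \<in> (\<lambda>s. x \<otimes> inv s) ` S \<union> (\<lambda>s. x \<otimes> s) ` S"
      using s by auto
  qed
qed (use finite_S in auto)

lemma E_nonneg: "0 \<le> E f x"
  by (simp add: grad_pow_def sum_nonneg)

lemma E_edge:
  assumes "x \<in> carrier G" "y \<in> nbrs x"
  shows "\<bar>f y - f x\<bar> powr p \<le> E f x"
  unfolding grad_pow_def
  by (rule member_le_sum) (use assms finite_nbrs in auto)

lemma E_add_le: "E (\<lambda>x. f x + g x) x \<le> 2 powr p * (E f x + E g x)"
proof -
  have "\<bar>(f y + g y) - (f x + g x)\<bar> powr p
      \<le> 2 powr p * (\<bar>f y - f x\<bar> powr p + \<bar>g y - g x\<bar> powr p)" for y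
    using powr_add_le[of p "f y - f x" "g y - g x"] by (simp add: algebra_simps)
  then show ?thesis
    unfolding grad_pow_def sum.distrib[symmetric] sum_distrib_left by (rule sum_mono)
qed

lemma E_cmult: "E (\<lambda>x. c * f x) x = \<bar>c\<bar> powr p * E f x"
  unfolding grad_pow_def sum_distrib_left
  by (rule sum.cong) (auto simp flip: right_diff_distrib simp: abs_mult powr_mult)

lemma E_uminus: "E (\<lambda>x. - f x) x = E f x"
  using E_cmult[of "-1" f] by simp

lemma E_lipschitz:
  assumes "\<And>y. y \<in> nbrs x \<Longrightarrow> \<bar>g y - g x\<bar> \<le> \<bar>f y - f x\<bar>"
  shows "E g x \<le> E f x"
  unfolding grad_pow_def using assms by (intro sum_mono powr_mono2) auto

text \<open>The discrete product rule: the difference of \<open>f g\<close> along an edge \<open>(x, y)\<close> is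
  \<open>f y (g y - g x) + g x (f y - f x)\<close>.\<close>
lemma E_mult_le:
  assumes "\<And>y. y \<in> carrier G \<Longrightarrow> \<bar>f y\<bar> \<le> M"
  shows "E (\<lambda>x. f x * g x) x \<le> 2 powr p * (M powr p * E g x + \<bar>g x\<bar> powr p * E f x)"
proof -
  have "\<bar>f y * g y - f x * g x\<bar> powr p
      \<le> 2 powr p * (M powr p * \<bar>g y - g x\<bar> powr p + \<bar>g x\<bar> powr p * \<bar>f y - f x\<bar> powr p)"
    if y: "y \<in> nbrs x" for y
  proof -
    have "\<bar>f y * g y - f x * g x\<bar> powr p = \<bar>f y * (g y - g x) + g x * (f y - f x)\<bar> powr p"
      by (simp add: algebra_simps)
    also have "\<dots> \<le> 2 powr p * (\<bar>f y * (g y - g x)\<bar> powr p + \<bar>g x * (f y - f x)\<bar> powr p)"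
      by (rule powr_add_le) simp
    also have "\<bar>f y * (g y - g x)\<bar> powr p \<le> (M * \<bar>g y - g x\<bar>) powr p"
      using assms[OF nbrs_carrier[OF y]]
      by (intro powr_mono2) (auto simp: abs_mult intro: mult_right_mono)
    finally show ?thesis
      using assms[OF nbrs_carrier[OF y]] by (simp add: abs_mult powr_mult)
  qed
  then show ?thesis
    unfolding grad_pow_def sum.distrib[symmetric] sum_distrib_left by (intro sum_mono) auto
qed

lemma E_tendsto_zero:
  assumes "x \<in> carrier G" "\<And>y. y \<in> carrier G \<Longrightarrow> (\<lambda>n. f n y) \<longlonglongrightarrow> 0"
  shows "(\<lambda>n. E (f n) x) \<longlonglongrightarrow> 0"
proof -
  have "(\<lambda>n. \<Sum>y\<in>nbrs x. \<bar>f n y - f n x\<bar> powr p) \<longlonglongrightarrow> (\<Sum>y\<in>nbrs x. 0)"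
  proof (rule tendsto_sum)
    fix y assume "y \<in> nbrs x"
    then have "(\<lambda>n. f n y - f n x) \<longlonglongrightarrow> 0 - 0"
      using assms nbrs_carrier by (intro tendsto_diff) auto
    then show "(\<lambda>n. \<bar>f n y - f n x\<bar> powr p) \<longlonglongrightarrow> 0"
      by (intro tendsto_powr_zero) auto
  qed
  then show ?thesis by (simp add: grad_pow_def)
qed

lemma D_outside: "f \<in> D \<Longrightarrow> x \<notin> carrier G \<Longrightarrow> f x = 0"
  by (simp add: Dp_def group_funs_def)

lemma D_summable: "f \<in> D \<Longrightarrow> E f summable_on carrier G"
  by (simp add: Dp_def)

lemma D_I:
  assumes "\<And>x. x \<notin> carrier G \<Longrightarrow> f x = 0" "w summable_on carrier G"
    "\<And>x. x \<in> carrier G \<Longrightarrow> E f x \<le> w x"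
  shows "f \<in> D"
  unfolding Dp_def group_funs_def using assms
  by (auto intro!: summable_on_comparison_test[OF assms(2)] E_nonneg)

lemma D_add: "f \<in> D \<Longrightarrow> g \<in> D \<Longrightarrow> (\<lambda>x. f x + g x) \<in> D"
  by (rule D_I[where w = "\<lambda>x. 2 powr p * (E f x + E g x)"])
    (auto simp: D_outside E_add_le intro!: summable_on_cmult_right summable_on_add D_summable)

lemma D_cmult: "f \<in> D \<Longrightarrow> (\<lambda>x. c * f x) \<in> D"
  by (rule D_I[where w = "\<lambda>x. \<bar>c\<bar> powr p * E f x"])
    (auto simp: D_outside E_cmult intro!: summable_on_cmult_right D_summable)

lemma D_uminus: "f \<in> D \<Longrightarrow> (\<lambda>x. - f x) \<in> D"
  using D_cmult[of f "-1"] by simp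

lemma D_diff: "f \<in> D \<Longrightarrow> g \<in> D \<Longrightarrow> (\<lambda>x. f x - g x) \<in> D"
  using D_add[OF _ D_uminus] by fastforce

lemma E_cst: "x \<in> carrier G \<Longrightarrow> E (cst c) x = 0"
  unfolding grad_pow_def by (rule sum.neutral) (auto simp: const_fun_def nbrs_carrier)

lemma D_cst: "cst c \<in> D"
  by (rule D_I[where w = "\<lambda>x. 0"]) (simp_all add: E_cst, simp add: const_fun_def)

lemma D_zero: "(\<lambda>x. 0) \<in> D"
  using D_cst[of 0] by (simp add: const_fun_def)

lemma D_lipschitz:
  assumes "f \<in> D" "\<And>x. x \<notin> carrier G \<Longrightarrow> g x = 0"
    and "\<And>x y. x \<in> carrier G \<Longrightarrow> y \<in> carrier G \<Longrightarrow> \<bar>g y - g x\<bar> \<le> \<bar>f y - f x\<bar>"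
  shows "g \<in> D"
  by (rule D_I[where w = "E f"]) (auto simp: D_summable assms nbrs_carrier intro!: E_lipschitz)

text \<open>The gradient of \<open>f\<close> vanishes at every vertex that neither lies in the support nor is
  adjacent to it.\<close>
lemma D_finsupp:
  assumes "\<And>x. x \<notin> carrier G \<Longrightarrow> f x = 0" "finite {x \<in> carrier G. f x \<noteq> 0}"
  shows "f \<in> D"
proof -
  let ?F = "{x \<in> carrier G. f x \<noteq> 0}"
  have sym: "x \<in> nbrs y" if xy: "y \<in> nbrs x" "x \<in> carrier G" for x y
  proof -
    obtain s where s: "s \<in> S" "y \<in> carrier G" "x = y \<otimes> s \<or> x = y \<otimes> inv s" "y \<noteq> x"
      using xy by (auto simp: cayley_nbrs_def)
    moreover have "s \<in> carrier G" using s S_carrier by auto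
    ultimately have "y = x \<otimes> inv s \<or> y = x \<otimes> s"
      by (auto simp: m_assoc)
    then show ?thesis using s xy by (auto simp: cayley_nbrs_def)
  qed
  let ?F' = "?F \<union> (\<Union>y\<in>?F. nbrs y)"
  have "finite ?F'" using assms finite_nbrs by auto
  then have "E f summable_on ?F'" by (rule summable_on_finite)
  moreover have "E f x = 0" if "x \<in> carrier G" "x \<notin> ?F'" for x
    unfolding grad_pow_def
  proof (rule sum.neutral, rule)
    fix y assume "y \<in> nbrs x"
    then have "f y = 0" "f x = 0" using that sym nbrs_carrier by blast+
    then show "\<bar>f y - f x\<bar> powr p = 0" by simp
  qed
  ultimately have "E f summable_on carrier G"
    using summable_on_cong_neutral[of "carrier G" ?F' "E f" "E f"] nbrs_carrier by blast
  then show ?thesis using assms by (simp add: Dp_def group_funs_def)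
qed

end

definition clamp :: "real \<Rightarrow> real \<Rightarrow> real" where
  "clamp r t = max (- r) (min r t)"

lemma clamp_zero [simp]: "r \<ge> 0 \<Longrightarrow> clamp r 0 = 0"
  by (simp add: clamp_def)

lemma clamp_id: "\<bar>t\<bar> \<le> r \<Longrightarrow> clamp r t = t"
  by (auto simp: clamp_def)

lemma abs_clamp_le: "r \<ge> 0 \<Longrightarrow> \<bar>clamp r t\<bar> \<le> r"
  by (auto simp: clamp_def)

lemma clamp_lipschitz: "\<bar>clamp r s - clamp r t\<bar> \<le> \<bar>s - t\<bar>"
  by (auto simp: clamp_def max_def min_def)

text \<open>Soft thresholding \<open>t \<mapsto> t - clamp r t\<close> is, like truncation, a contraction, so both
  operate on functions of finite energy.\<close>
lemma clamp_remainder_lipschitz: "\<bar>(s - clamp r s) - (t - clamp r t)\<bar> \<le> \<bar>s - t\<bar>"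
  by (auto simp: clamp_def max_def min_def)

context cayley_graph
begin

lemma Ip_nonneg: "0 \<le> Ip G S p f"
  unfolding Ip_def by (intro infsum_nonneg E_nonneg)

lemma energy_nonneg: "0 \<le> energy f"
  by (simp add: energy_def Ip_nonneg)

lemma energy_add_le:
  assumes "f \<in> D" "g \<in> D"
  shows "energy (\<lambda>x. f x + g x) \<le> 2 powr p * (energy f + energy g)"
proof -
  have "Ip G S p (\<lambda>x. f x + g x) \<le> infsum (\<lambda>x. 2 powr p * (E f x + E g x)) (carrier G)"
    unfolding Ip_def
    using assms E_add_le
    by (intro infsum_mono summable_on_cmult_right summable_on_add) (auto simp: D_summable D_add)
  also have "\<dots> = 2 powr p * (Ip G S p f + Ip G S p g)"
    unfolding Ip_def using assms
    by (simp add: infsum_cmult_right' infsum_add D_summable)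
  finally show ?thesis
    using powr_add_le[of p "f \<one>" "g \<one>"] by (simp add: energy_def algebra_simps)
qed

lemma energy_cmult: "energy (\<lambda>x. c * f x) = \<bar>c\<bar> powr p * energy f"
proof -
  have "Ip G S p (\<lambda>x. c * f x) = infsum (\<lambda>x. \<bar>c\<bar> powr p * E f x) (carrier G)"
    unfolding Ip_def by (intro infsum_cong) (simp add: E_cmult)
  then show ?thesis
    by (simp add: energy_def Ip_def abs_mult powr_mult infsum_cmult_right' algebra_simps)
qed

lemma energy_minus_commute: "energy (\<lambda>x. f x - g x) = energy (\<lambda>x. g x - f x)"
  using energy_cmult[of "-1" "\<lambda>x. f x - g x"] by simp

lemma energy_cst: "energy (cst c) = \<bar>c\<bar> powr p"
proof -
  have "Ip G S p (cst c) = 0"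
    unfolding Ip_def by (intro infsum_0) (simp add: E_cst)
  then show ?thesis by (simp add: energy_def const_fun_def)
qed

lemma energy_zero: "energy (\<lambda>x. 0) = 0"
  using energy_cst[of 0] by (simp add: const_fun_def)

lemma E_le_energy:
  assumes "f \<in> D" "x \<in> carrier G"
  shows "E f x \<le> energy f"
proof -
  have "sum (E f) {x} \<le> infsum (E f) (carrier G)"
    using assms by (intro finite_sum_le_infsum) (auto simp: D_summable E_nonneg)
  then show ?thesis by (simp add: energy_def Ip_def add_increasing2)
qed

lemma tendsto_energy_sum:
  assumes "\<And>n. f n \<in> D" "\<And>n. g n \<in> D"
    and "(\<lambda>n. energy (f n)) \<longlonglongrightarrow> 0" "(\<lambda>n. energy (g n)) \<longlonglongrightarrow> 0"
  shows "(\<lambda>n. energy (\<lambda>x. f n x + g n x)) \<longlonglongrightarrow> 0"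
proof (rule tendsto_sandwich[OF _ _ tendsto_const])
  have "(\<lambda>n. 2 powr p * (energy (f n) + energy (g n))) \<longlonglongrightarrow> 2 powr p * (0 + 0)"
    by (intro tendsto_intros assms)
  then show "(\<lambda>n. 2 powr p * (energy (f n) + energy (g n))) \<longlonglongrightarrow> 0" by simp
qed (use assms energy_add_le in \<open>auto simp: energy_nonneg\<close>)

text \<open>This is where the connectedness of the Cayley graph enters. The energy controls the
  difference along each edge, and \<open>y\<close> and \<open>y \<otimes> x\<close> are joined by a path spelled by a word for
  \<open>x\<close> in the generators; the induction over this word is uniform in the starting point \<open>y\<close>.\<close>
lemma tendsto_pointwise:
  assumes D: "\<And>n. f n \<in> D" and lim: "(\<lambda>n. energy (f n)) \<longlonglongrightarrow> 0" and x: "x \<in> carrier G"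
  shows "(\<lambda>n. f n x) \<longlonglongrightarrow> 0"
proof -
  have edge: "(\<lambda>n. f n z - f n y) \<longlonglongrightarrow> 0" if "y \<in> carrier G" "z \<in> nbrs y" for y z
  proof (rule tendsto_zero_from_powr[of _ p])
    show "(\<lambda>n. \<bar>f n z - f n y\<bar> powr p) \<longlonglongrightarrow> 0"
      by (rule tendsto_sandwich[OF _ _ tendsto_const lim])
        (use order_trans[OF E_edge[OF that] E_le_energy[OF D that(1)]] in auto)
  qed simp
  have step: "(\<lambda>n. f n (y \<otimes> s) - f n y) \<longlonglongrightarrow> 0"
    if "y \<in> carrier G" "s \<in> S \<or> (\<exists>t\<in>S. s = inv t)" for y s
  proof (cases "y \<otimes> s = y")
    case False
    have s: "s \<in> carrier G" using that S_carrier by auto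
    have y: "y = (y \<otimes> s) \<otimes> inv s" using that s by (simp add: m_assoc)
    have "\<exists>t\<in>S. y = (y \<otimes> s) \<otimes> t \<or> y = (y \<otimes> s) \<otimes> inv t"
      using that(2)
    proof
      assume "\<exists>t\<in>S. s = inv t"
      then obtain t where t: "t \<in> S" "s = inv t" by blast
      then have "inv s = t" using S_carrier by (auto intro: inv_inv)
      then show ?thesis using y t by auto
    qed (use y in blast)
    then have "y \<otimes> s \<in> nbrs y"
      using False s \<open>y \<in> carrier G\<close> by (simp add: cayley_nbrs_def)
    then show ?thesis using edge that by blast
  qed simp
  have "x \<in> generate G S" using x generates by simp
  then have "\<forall>y\<in>carrier G. (\<lambda>n. f n (y \<otimes> x) - f n y) \<longlonglongrightarrow> 0"
  proof (induction rule: generate.induct)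
    case (eng h k)
    have hk: "h \<in> carrier G" "k \<in> carrier G" using eng.hyps generates by auto
    show ?case
    proof
      fix y assume y: "y \<in> carrier G"
      have "(\<lambda>n. (f n ((y \<otimes> h) \<otimes> k) - f n (y \<otimes> h)) + (f n (y \<otimes> h) - f n y)) \<longlonglongrightarrow> 0 + 0"
        using eng.IH y hk by (intro tendsto_add) auto
      then show "(\<lambda>n. f n (y \<otimes> (h \<otimes> k)) - f n y) \<longlonglongrightarrow> 0"
        using y hk by (simp add: m_assoc)
    qed
  qed (use step in auto)
  then have "(\<lambda>n. f n x - f n \<one>) \<longlonglongrightarrow> 0" using x by (metis l_one one_closed)
  moreover have "(\<lambda>n. f n \<one>) \<longlonglongrightarrow> 0"
  proof (rule tendsto_zero_from_powr[of _ p])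
    show "(\<lambda>n. \<bar>f n \<one>\<bar> powr p) \<longlonglongrightarrow> 0"
      by (rule tendsto_sandwich[OF _ _ tendsto_const lim]) (auto simp: energy_def Ip_nonneg)
  qed simp
  ultimately show ?thesis using tendsto_add by fastforce
qed

text \<open>Dominated convergence for energies: pointwise convergence forces the gradients, which are
  finite sums, to converge at each vertex. The functions \<open>v n\<close> carry the part of the bound that
  depends on the index; in the application they are the errors of an approximation in energy.\<close>
lemma tendsto_energy_dominated:
  assumes f: "\<And>x. x \<in> carrier G \<Longrightarrow> (\<lambda>n. f n x) \<longlonglongrightarrow> 0"
    and v: "\<And>n. v n \<in> D" "(\<lambda>n. energy (v n)) \<longlonglongrightarrow> 0"
    and w: "w summable_on carrier G" "\<And>x. x \<in> carrier G \<Longrightarrow> 0 \<le> w x"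
    and dom: "\<And>n x. x \<in> carrier G \<Longrightarrow> E (f n) x \<le> w x + c * E (v n) x"
    and c: "c \<ge> 0"
  shows "(\<lambda>n. energy (f n)) \<longlonglongrightarrow> 0"
proof -
  have Iv: "(\<lambda>n. Ip G S p (v n)) \<longlonglongrightarrow> 0"
    by (rule tendsto_sandwich[OF _ _ tendsto_const v(2)]) (auto simp: energy_def Ip_nonneg)
  have "(\<lambda>n. infsum (E (f n)) (carrier G)) \<longlonglongrightarrow> 0"
  proof (rule infsum_tendsto_zero_almost_dominated[where w = w and b = "\<lambda>n x. c * E (v n) x"])
    have "(\<lambda>n. c * Ip G S p (v n)) \<longlonglongrightarrow> c * 0" by (intro tendsto_intros Iv)
    then show "(\<lambda>n. infsum (\<lambda>x. c * E (v n) x) (carrier G)) \<longlonglongrightarrow> 0"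
      by (simp add: Ip_def infsum_cmult_right')
  qed (use E_nonneg E_tendsto_zero f w v dom c in \<open>auto intro!: summable_on_cmult_right D_summable\<close>)
  moreover have "(\<lambda>n. \<bar>f n \<one>\<bar> powr p) \<longlonglongrightarrow> 0"
    by (rule tendsto_powr_zero) (auto intro: f)
  ultimately show ?thesis unfolding energy_def Ip_def using tendsto_add by fastforce
qed

section \<open>Closures in the energy norm\<close>

lemma Dp_norm_less_iff:
  assumes "\<epsilon> > 0"
  shows "Dp_norm G S p f < \<epsilon> \<longleftrightarrow> energy f < \<epsilon> powr p"
proof -
  have norm: "Dp_norm G S p f = energy f powr (1 / p)" by (simp add: Dp_norm_def energy_def)
  have e: "(\<epsilon> powr p) powr (1 / p) = \<epsilon>" using assms by (simp add: powr_powr)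
  show ?thesis
  proof
    assume "energy f < \<epsilon> powr p"
    then have "energy f powr (1 / p) < (\<epsilon> powr p) powr (1 / p)"
      by (intro powr_less_mono2) (auto simp: energy_nonneg)
    then show "Dp_norm G S p f < \<epsilon>" by (simp add: norm e)
  next
    assume lt: "Dp_norm G S p f < \<epsilon>"
    show "energy f < \<epsilon> powr p"
    proof (rule ccontr)
      assume "\<not> energy f < \<epsilon> powr p"
      then have "(\<epsilon> powr p) powr (1 / p) \<le> energy f powr (1 / p)"
        by (intro powr_mono2) auto
      then show False using lt by (simp add: norm e)
    qed
  qed
qed

lemma cl_iff:
  "f \<in> cl A \<longleftrightarrow> f \<in> D \<and> (\<forall>\<epsilon>>0. \<exists>g\<in>A \<inter> D. energy (\<lambda>x. f x - g x) < \<epsilon>)" (is "_ \<longleftrightarrow> _ \<and> ?R")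
proof -
  have "(\<forall>\<epsilon>>0. \<exists>g\<in>A \<inter> D. Dp_norm G S p (\<lambda>x. f x - g x) < \<epsilon>) \<longleftrightarrow> ?R"
  proof
    assume L: "\<forall>\<epsilon>>0. \<exists>g\<in>A \<inter> D. Dp_norm G S p (\<lambda>x. f x - g x) < \<epsilon>"
    show ?R
    proof (intro allI impI)
      fix \<epsilon> :: real assume "\<epsilon> > 0"
      then show "\<exists>g\<in>A \<inter> D. energy (\<lambda>x. f x - g x) < \<epsilon>"
        using L[rule_format, of "\<epsilon> powr (1/p)"] by (auto simp: Dp_norm_less_iff powr_powr)
    qed
  next
    assume ?R
    then show "\<forall>\<epsilon>>0. \<exists>g\<in>A \<inter> D. Dp_norm G S p (\<lambda>x. f x - g x) < \<epsilon>"
      by (auto simp: Dp_norm_less_iff)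
  qed
  then show ?thesis by (simp add: Dp_closure_def)
qed

lemma cl_D: "f \<in> cl A \<Longrightarrow> f \<in> D"
  by (simp add: cl_iff)

lemma cl_sequence:
  assumes "f \<in> cl A"
  obtains g where "\<And>n. g n \<in> A" "\<And>n. g n \<in> D" "(\<lambda>n. energy (\<lambda>x. f x - g n x)) \<longlonglongrightarrow> 0"
proof -
  have "\<forall>n. \<exists>g\<in>A \<inter> D. energy (\<lambda>x. f x - g x) < inverse (real (Suc n))"
    using assms by (simp add: cl_iff)
  then obtain g where g: "\<And>n. g n \<in> A \<inter> D" "\<And>n. energy (\<lambda>x. f x - g n x) < inverse (real (Suc n))"
    by metis
  have "(\<lambda>n. energy (\<lambda>x. f x - g n x)) \<longlonglongrightarrow> 0"
    by (rule tendsto_sandwich[OF _ _ tendsto_const LIMSEQ_inverse_real_of_nat])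
      (use g(2) in \<open>auto simp: energy_nonneg less_imp_le\<close>)
  then show thesis using that g(1) by blast
qed

lemma clI:
  assumes "f \<in> D" "\<And>n. g n \<in> A" "\<And>n. g n \<in> D" "(\<lambda>n. energy (\<lambda>x. f x - g n x)) \<longlonglongrightarrow> 0"
  shows "f \<in> cl A"
  unfolding cl_iff
proof (intro conjI allI impI)
  fix \<epsilon> :: real assume "\<epsilon> > 0"
  then have "eventually (\<lambda>n. energy (\<lambda>x. f x - g n x) < \<epsilon>) sequentially"
    by (rule order_tendstoD(2)[OF assms(4)])
  then obtain n where "energy (\<lambda>x. f x - g n x) < \<epsilon>"
    using eventually_happens'[OF sequentially_bot] by blast
  then show "\<exists>g\<in>A \<inter> D. energy (\<lambda>x. f x - g x) < \<epsilon>" using assms by blast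
qed (fact assms(1))

lemma cl_superset: "f \<in> A \<Longrightarrow> f \<in> D \<Longrightarrow> f \<in> cl A"
  by (rule clI[where g = "\<lambda>n. f"]) (auto simp: energy_zero)

text \<open>Closures are closed. A diagonal choice of approximants works because the energy satisfies
  the weak triangle inequality.\<close>
lemma cl_closed:
  assumes "f \<in> D" "\<And>n. g n \<in> cl A" "(\<lambda>n. energy (\<lambda>x. f x - g n x)) \<longlonglongrightarrow> 0"
  shows "f \<in> cl A"
proof -
  have "\<exists>h\<in>A \<inter> D. energy (\<lambda>x. g n x - h x) < inverse (real (Suc n))" for n
    using assms(2)[of n] by (simp add: cl_iff)
  then obtain h where h: "\<And>n. h n \<in> A \<inter> D"
      "\<And>n. energy (\<lambda>x. g n x - h n x) < inverse (real (Suc n))"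
    by metis
  have lim: "(\<lambda>n. energy (\<lambda>x. g n x - h n x)) \<longlonglongrightarrow> 0"
    by (rule tendsto_sandwich[OF _ _ tendsto_const LIMSEQ_inverse_real_of_nat])
      (use h(2) in \<open>auto simp: energy_nonneg less_imp_le\<close>)
  have "(\<lambda>n. energy (\<lambda>x. (f x - g n x) + (g n x - h n x))) \<longlonglongrightarrow> 0"
    by (rule tendsto_energy_sum[OF _ _ assms(3) lim])
      (use assms(1) h(1) cl_D[OF assms(2)] in \<open>auto intro!: D_diff\<close>)
  then show ?thesis using h assms by (intro clI[where g = h]) auto
qed

lemma cl_add:
  assumes "f \<in> cl A" "g \<in> cl A" "\<And>u v. u \<in> A \<Longrightarrow> v \<in> A \<Longrightarrow> (\<lambda>x. u x + v x) \<in> A"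
  shows "(\<lambda>x. f x + g x) \<in> cl A"
proof -
  obtain u where u: "\<And>n. u n \<in> A" "\<And>n. u n \<in> D" "(\<lambda>n. energy (\<lambda>x. f x - u n x)) \<longlonglongrightarrow> 0"
    using cl_sequence[OF assms(1)] by blast
  obtain v where v: "\<And>n. v n \<in> A" "\<And>n. v n \<in> D" "(\<lambda>n. energy (\<lambda>x. g x - v n x)) \<longlonglongrightarrow> 0"
    using cl_sequence[OF assms(2)] by blast
  have "(\<lambda>n. energy (\<lambda>x. (f x - u n x) + (g x - v n x))) \<longlonglongrightarrow> 0"
    by (rule tendsto_energy_sum[OF _ _ u(3) v(3)]) (use u v assms cl_D in \<open>auto intro!: D_diff\<close>)
  then show ?thesis
    using u v assms cl_D
    by (intro clI[where g = "\<lambda>n x. u n x + v n x"]) (auto intro!: D_add simp: algebra_simps)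
qed

lemma cl_cmult:
  assumes "f \<in> cl A" "\<And>u. u \<in> A \<Longrightarrow> (\<lambda>x. c * u x) \<in> A"
  shows "(\<lambda>x. c * f x) \<in> cl A"
proof -
  obtain u where u: "\<And>n. u n \<in> A" "\<And>n. u n \<in> D" "(\<lambda>n. energy (\<lambda>x. f x - u n x)) \<longlonglongrightarrow> 0"
    using cl_sequence[OF assms(1)] by blast
  have "(\<lambda>n. \<bar>c\<bar> powr p * energy (\<lambda>x. f x - u n x)) \<longlonglongrightarrow> \<bar>c\<bar> powr p * 0"
    by (intro tendsto_intros u)
  then have "(\<lambda>n. energy (\<lambda>x. c * f x - c * u n x)) \<longlonglongrightarrow> 0"
    by (simp flip: energy_cmult right_diff_distrib)
  then show ?thesis
    using u assms cl_D by (intro clI[where g = "\<lambda>n x. c * u n x"]) (auto intro!: D_cmult)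
qed

section \<open>Truncation\<close>

lemma D_clamp: "f \<in> D \<Longrightarrow> r \<ge> 0 \<Longrightarrow> (\<lambda>x. clamp r (f x)) \<in> D"
  by (rule D_lipschitz[of f]) (auto simp: D_outside clamp_lipschitz)

lemma tendsto_energy_contraction:
  assumes f: "\<And>x. x \<in> carrier G \<Longrightarrow> (\<lambda>n. f n x) \<longlonglongrightarrow> 0"
    and u: "u \<in> D" and le: "\<And>n x y. \<bar>f n y - f n x\<bar> \<le> \<bar>u y - u x\<bar>"
  shows "(\<lambda>n. energy (f n)) \<longlonglongrightarrow> 0"
proof (rule tendsto_energy_dominated[where w = "E u" and v = "\<lambda>n x. 0" and c = 0])
  show "(\<lambda>n. energy (\<lambda>x. 0)) \<longlonglongrightarrow> 0" unfolding energy_zero by (rule tendsto_const)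
  show "E (f n) x \<le> E u x + 0 * E (\<lambda>x. 0) x" for n x
    unfolding mult_zero_left add_0_right by (rule E_lipschitz) (rule le)
  show "E u summable_on carrier G" using u by (rule D_summable)
  show "(\<lambda>x. 0) \<in> D" by (rule D_zero)
  show "0 \<le> E u x" for x by (rule E_nonneg)
  show "0 \<le> (0::real)" by (rule order_refl)
qed (fact f)

lemma tendsto_clamp_large:
  assumes "f \<in> D"
  shows "(\<lambda>n. energy (\<lambda>x. f x - clamp (real n) (f x))) \<longlonglongrightarrow> 0"
proof (rule tendsto_energy_contraction[OF _ assms])
  fix x
  obtain N where "\<bar>f x\<bar> \<le> real N" using real_arch_simple by blast
  then have "f x - clamp (real n) (f x) = 0" if "n \<ge> N" for n
    using that clamp_id[of "f x" "real n"] by simp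
  then show "(\<lambda>n. f x - clamp (real n) (f x)) \<longlonglongrightarrow> 0"
    by (intro tendsto_eventually) (auto simp: eventually_sequentially)
qed (rule clamp_remainder_lipschitz)

lemma tendsto_clamp_small:
  assumes "f \<in> D"
  shows "(\<lambda>n. energy (\<lambda>x. clamp (inverse (real (Suc n))) (f x))) \<longlonglongrightarrow> 0"
proof (rule tendsto_energy_contraction[OF _ assms])
  fix x
  have "\<bar>clamp (inverse (real (Suc n))) (f x)\<bar> \<le> inverse (real (Suc n))" for n
    by (rule abs_clamp_le) simp
  then show "(\<lambda>n. clamp (inverse (real (Suc n))) (f x)) \<longlonglongrightarrow> 0"
    by (intro metric_tendsto_imp_tendsto[OF LIMSEQ_inverse_real_of_nat] always_eventually) simp
qed (rule clamp_lipschitz)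


section \<open>The algebra of bounded functions of finite energy\<close>

abbreviation "D0 \<equiv> cl (finsupp_funs G)"
abbreviation "B0 \<equiv> B_closure_finsupp G S p"

lemma BD_iff: "f \<in> BD \<longleftrightarrow> f \<in> D \<and> (\<exists>C. \<forall>x\<in>carrier G. \<bar>f x\<bar> \<le> C)"
  by (auto simp: BDp_def ellinf_def Dp_def)

lemma BD_D: "f \<in> BD \<Longrightarrow> f \<in> D"
  by (simp add: BD_iff)

lemma B0_iff: "f \<in> B0 \<longleftrightarrow> f \<in> D0 \<and> f \<in> BD"
  by (auto simp: B_closure_finsupp_def BDp_def cl_iff)

lemma BD_bound:
  assumes "f \<in> BD"
  obtains C where "C > 0" "\<And>x. \<bar>f x\<bar> \<le> C"
proof -
  obtain C where "\<And>x. x \<in> carrier G \<Longrightarrow> \<bar>f x\<bar> \<le> C" using assms by (auto simp: BD_iff)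
  then have "\<bar>f x\<bar> \<le> \<bar>C\<bar> + 1" for x
    using D_outside[OF BD_D[OF assms], of x] by (cases "x \<in> carrier G") fastforce+
  then show thesis using that[of "\<bar>C\<bar> + 1"] by auto
qed

lemma BD_I: "f \<in> D \<Longrightarrow> (\<And>x. x \<in> carrier G \<Longrightarrow> \<bar>f x\<bar> \<le> C) \<Longrightarrow> f \<in> BD"
  by (auto simp: BD_iff)

lemma BD_add:
  assumes "f \<in> BD" "g \<in> BD"
  shows "(\<lambda>x. f x + g x) \<in> BD"
proof -
  obtain C C' where "\<And>x. \<bar>f x\<bar> \<le> C" "\<And>x. \<bar>g x\<bar> \<le> C'" using assms BD_bound by metis
  then have "\<bar>f x + g x\<bar> \<le> C + C'" for x by (meson abs_triangle_ineq add_mono order_trans)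
  then show ?thesis using assms by (intro BD_I[where C = "C + C'"]) (auto intro: D_add BD_D)
qed

lemma BD_cmult:
  assumes "f \<in> BD"
  shows "(\<lambda>x. c * f x) \<in> BD"
proof -
  obtain C where "\<And>x. \<bar>f x\<bar> \<le> C" using assms BD_bound by metis
  then have "\<bar>c * f x\<bar> \<le> \<bar>c\<bar> * C" for x by (simp add: abs_mult mult_left_mono)
  then show ?thesis using assms by (intro BD_I[where C = "\<bar>c\<bar> * C"]) (auto intro: D_cmult BD_D)
qed

lemma BD_diff: "f \<in> BD \<Longrightarrow> g \<in> BD \<Longrightarrow> (\<lambda>x. f x - g x) \<in> BD"
  using BD_add[OF _ BD_cmult[of g "-1"], of f] by simp

lemma BD_mult:
  assumes "f \<in> BD" "g \<in> BD"
  shows "(\<lambda>x. f x * g x) \<in> BD"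
proof -
  obtain K where K: "K > 0" "\<And>x. \<bar>f x\<bar> \<le> K" using assms BD_bound by metis
  obtain L where L: "L > 0" "\<And>x. \<bar>g x\<bar> \<le> L" using assms BD_bound by metis
  show ?thesis
  proof (rule BD_I[where C = "K * L"])
    show "(\<lambda>x. f x * g x) \<in> D"
    proof (rule D_I)
      show "(\<lambda>x. 2 powr p * (K powr p * E g x + L powr p * E f x)) summable_on carrier G"
        using assms by (intro summable_on_cmult_right summable_on_add D_summable BD_D)
      fix x assume "x \<in> carrier G"
      have "\<bar>g x\<bar> powr p * E f x \<le> L powr p * E f x"
        using L by (intro mult_right_mono powr_mono2) (auto simp: E_nonneg)
      then show "E (\<lambda>x. f x * g x) x \<le> 2 powr p * (K powr p * E g x + L powr p * E f x)"
        by (intro order_trans[OF E_mult_le[of f K g x]] mult_left_mono add_left_mono)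
          (use K in auto)
    qed (use assms in \<open>auto dest!: BD_D simp: D_outside\<close>)
  qed (use K L in \<open>auto simp: abs_mult intro!: mult_mono intro: less_imp_le\<close>)
qed

lemma BD_cst: "cst c \<in> BD"
  by (rule BD_I[OF D_cst, where C = "\<bar>c\<bar>"]) (auto simp: const_fun_def)

lemma BD_clamp: "f \<in> D \<Longrightarrow> r \<ge> 0 \<Longrightarrow> (\<lambda>x. clamp r (f x)) \<in> BD"
  by (rule BD_I[OF D_clamp]) (auto intro: abs_clamp_le)

section \<open>The ideal of bounded limits of finitely supported functions\<close>

lemma finsupp_add: "u \<in> finsupp_funs G \<Longrightarrow> v \<in> finsupp_funs G \<Longrightarrow> (\<lambda>x. u x + v x) \<in> finsupp_funs G"
proof -
  assume u: "u \<in> finsupp_funs G" and v: "v \<in> finsupp_funs G"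
  have "{x \<in> carrier G. u x + v x \<noteq> 0} \<subseteq> {x \<in> carrier G. u x \<noteq> 0} \<union> {x \<in> carrier G. v x \<noteq> 0}"
    by auto
  then show ?thesis using u v
    by (auto simp: finsupp_funs_def group_funs_def intro: finite_subset)
qed

lemma finsupp_supp_subset:
  assumes "u \<in> finsupp_funs G" "\<And>x. u x = 0 \<Longrightarrow> v x = 0"
  shows "v \<in> finsupp_funs G"
proof -
  have "{x \<in> carrier G. v x \<noteq> 0} \<subseteq> {x \<in> carrier G. u x \<noteq> 0}" using assms(2) by auto
  then show ?thesis using assms by (auto simp: finsupp_funs_def group_funs_def intro: finite_subset)
qed

lemma finsupp_D: "u \<in> finsupp_funs G \<Longrightarrow> u \<in> D"
  by (auto simp: finsupp_funs_def group_funs_def intro!: D_finsupp)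

lemma D0_add: "f \<in> D0 \<Longrightarrow> g \<in> D0 \<Longrightarrow> (\<lambda>x. f x + g x) \<in> D0"
  by (rule cl_add) (auto intro: finsupp_add)

lemma D0_cmult: "f \<in> D0 \<Longrightarrow> (\<lambda>x. c * f x) \<in> D0"
  by (rule cl_cmult) (auto intro: finsupp_supp_subset)

lemma B0_add: "f \<in> B0 \<Longrightarrow> g \<in> B0 \<Longrightarrow> (\<lambda>x. f x + g x) \<in> B0"
  by (simp add: B0_iff D0_add BD_add)

text \<open>The absolute value of a \<open>p\<close>-summable function exceeds each positive threshold only finitely often, so its soft
  thresholdings are finitely supported, and they converge to it as the threshold tends to
  zero.\<close>
lemma ellp_subset_D0:
  assumes "g \<in> ellp G p" "g \<in> D"
  shows "g \<in> D0"
proof (rule clI[OF assms(2)])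
  let ?u = "\<lambda>n x. g x - clamp (inverse (real (Suc n))) (g x)"
  show "?u n \<in> finsupp_funs G" for n
  proof -
    let ?r = "inverse (real (Suc n))"
    let ?F = "{x \<in> carrier G. ?u n x \<noteq> 0}"
    have "finite ?F"
    proof (rule ccontr)
      assume inf: "infinite ?F"
      have sum: "(\<lambda>x. \<bar>g x\<bar> powr p) summable_on carrier G" using assms(1) by (simp add: ellp_def)
      have "(\<lambda>x. ?r powr p) summable_on ?F"
      proof (rule summable_on_comparison_test)
        show "(\<lambda>x. \<bar>g x\<bar> powr p) summable_on ?F"
          by (rule summable_on_subset_banach[OF sum]) auto
        fix x assume "x \<in> ?F"
        then have "?r \<le> \<bar>g x\<bar>" using clamp_id[of "g x" ?r] by fastforce
        then show "?r powr p \<le> \<bar>g x\<bar> powr p" by (intro powr_mono2) auto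
      qed auto
      then show False using inf infsum_diverge_constant[OF inf, of "?r powr p"] by simp
    qed
    then show ?thesis using D_outside[OF assms(2)] by (simp add: finsupp_funs_def group_funs_def)
  qed
  then show "?u n \<in> D" for n by (rule finsupp_D)
  show "(\<lambda>n. energy (\<lambda>x. g x - ?u n x)) \<longlonglongrightarrow> 0"
    using tendsto_clamp_small[OF assms(2)] by simp
qed

text \<open>\<open>B0\<close> is an ideal of \<open>BD\<close>. Finitely supported approximants \<open>v n\<close> of \<open>u\<close> need not be
  uniformly bounded, which the product rule requires; they are therefore truncated at a bound
  for \<open>u\<close>. The gradients of the truncations are controlled by those of \<open>v n\<close>, hence by a fixed
  function up to an error of vanishing energy, so that dominated convergence applies.\<close>
lemma B0_mult:
  assumes f: "f \<in> BD" and u: "u \<in> B0"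
  shows "(\<lambda>x. f x * u x) \<in> B0"
proof -
  obtain K where K: "K > 0" "\<And>x. \<bar>f x\<bar> \<le> K" using f BD_bound by metis
  have uBD: "u \<in> BD" and uD0: "u \<in> D0" using u by (auto simp: B0_iff)
  then obtain M where M: "M > 0" "\<And>x. \<bar>u x\<bar> \<le> M" using BD_bound by metis
  obtain v where v: "\<And>n. v n \<in> finsupp_funs G" "\<And>n. v n \<in> D"
      "(\<lambda>n. energy (\<lambda>x. u x - v n x)) \<longlonglongrightarrow> 0"
    using cl_sequence[OF uD0] by blast
  define w where "w n x = clamp M (v n x)" for n x
  have uD: "u \<in> D" and fD: "f \<in> D" using uBD f BD_D by auto
  have uvD: "(\<lambda>x. u x - v n x) \<in> D" for n using uD v by (intro D_diff)
  have uw: "\<bar>u x - w n x\<bar> \<le> \<bar>u x - v n x\<bar>" for n x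
    using clamp_lipschitz[of M "u x" "v n x"] clamp_id[OF M(2)[of x]] by (simp add: w_def)
  have bound: "\<bar>u x - w n x\<bar> \<le> 2 * M" for n x
    using M(2)[of x] abs_clamp_le[of M "v n x"] M(1) by (simp add: w_def)
  have wfin: "(\<lambda>x. f x * w n x) \<in> finsupp_funs G" for n
    by (rule finsupp_supp_subset[OF v(1)[of n]]) (use M in \<open>auto simp: w_def\<close>)
  have wlim: "(\<lambda>n. u x - w n x) \<longlonglongrightarrow> 0" if "x \<in> carrier G" for x
    by (rule tendsto_0_le[where K = 1, OF tendsto_pointwise[OF uvD v(3) that]]) (use uw in auto)
  (* The constants come from three applications of the weak triangle inequality, through
     Ew below. *)
  let ?q = "2 powr p"
  let ?W = "\<lambda>x. ?q * (K powr p * (?q * (1 + ?q) * E u x) + (2 * M) powr p * E f x)"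
  let ?c = "?q * (K powr p * (?q * ?q))"
  have Ew: "E (\<lambda>x. u x - w n x) x \<le> ?q * ((1 + ?q) * E u x + ?q * E (\<lambda>x. u x - v n x) x)"
    if "x \<in> carrier G" for n x
  proof -
    have "E (\<lambda>x. u x - w n x) x \<le> ?q * (E u x + E (w n) x)"
      using E_add_le[of u "\<lambda>x. - w n x" x] by (simp add: E_uminus)
    also have "E (w n) x \<le> E (v n) x"
      by (rule E_lipschitz) (simp add: w_def clamp_lipschitz)
    also have "E (v n) x \<le> ?q * (E u x + E (\<lambda>x. u x - v n x) x)"
      using E_add_le[of u "\<lambda>x. - (u x - v n x)" x] E_uminus[of "\<lambda>x. u x - v n x" x] by simp
    finally show ?thesis by (simp add: algebra_simps)
  qed
  have "(\<lambda>n. energy (\<lambda>x. f x * (u x - w n x))) \<longlonglongrightarrow> 0"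
  proof (rule tendsto_energy_dominated[OF _ uvD v(3), where w = ?W and c = ?c])
    fix x assume x: "x \<in> carrier G"
    show "(\<lambda>n. f x * (u x - w n x)) \<longlonglongrightarrow> 0"
      using tendsto_mult_right_zero[OF wlim[OF x]] .
    show "E (\<lambda>x. f x * (u x - w n x)) x \<le> ?W x + ?c * E (\<lambda>x. u x - v n x) x" for n
    proof -
      have "E (\<lambda>x. f x * (u x - w n x)) x
          \<le> ?q * (K powr p * E (\<lambda>x. u x - w n x) x + \<bar>u x - w n x\<bar> powr p * E f x)"
        by (rule E_mult_le) (rule K(2))
      also have "\<dots> \<le> ?q * (K powr p * (?q * ((1 + ?q) * E u x + ?q * E (\<lambda>x. u x - v n x) x))
          + (2 * M) powr p * E f x)"
        using bound[of x n]
        by (intro mult_left_mono add_mono mult_right_mono Ew[OF x] powr_mono2) (auto simp: E_nonneg)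
      finally show ?thesis by (simp add: algebra_simps)
    qed
    show "0 \<le> ?W x" by (auto intro!: add_nonneg_nonneg mult_nonneg_nonneg E_nonneg)
  next
    show "?W summable_on carrier G"
      by (intro summable_on_cmult_right summable_on_add D_summable uD fD)
    show "0 \<le> ?c" by simp
  qed
  then have "(\<lambda>n. energy (\<lambda>x. f x * u x - f x * w n x)) \<longlonglongrightarrow> 0"
    by (simp add: right_diff_distrib)
  then have "(\<lambda>x. f x * u x) \<in> D0"
    by (intro clI[OF BD_D[OF BD_mult[OF f uBD]] wfin finsupp_D[OF wfin]])
  then show ?thesis using BD_mult[OF f uBD] by (simp add: B0_iff)
qed

text \<open>A function that vanishes wherever \<open>u\<close> is small is a multiple of \<open>u\<^sup>2\<close>: the cofactor is
  \<open>g / max 1 u\<^sup>2\<close>, which lies in the algebra since \<open>t \<mapsto> 1 / max 1 t\<close> is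
  a contraction. For \<open>g = 1\<close> this says that an element of \<open>B0\<close> bounded away from zero
  generates the unit ideal.\<close>
lemma B0_of_vanishing:
  assumes g: "g \<in> BD" and u: "u \<in> B0"
    and zero: "\<And>x. x \<in> carrier G \<Longrightarrow> \<bar>u x\<bar> < 1 \<Longrightarrow> g x = 0"
  shows "g \<in> B0"
proof -
  define k where "k x = (if x \<in> carrier G then inverse (max 1 ((u x)\<^sup>2)) else 0)" for x
  have uBD: "u \<in> BD" using u by (simp add: B0_iff)
  have lip: "\<bar>inverse (max 1 s) - inverse (max 1 t)\<bar> \<le> \<bar>s - t\<bar>" for s t :: real
  proof -
    let ?s = "max 1 s" and ?t = "max 1 t"
    have pos: "?s > 0" "?t > 0" by auto
    have "inverse ?s - inverse ?t = (?t - ?s) * (inverse ?s * inverse ?t)"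
      using pos by (simp add: field_simps)
    then have "\<bar>inverse ?s - inverse ?t\<bar> = \<bar>?t - ?s\<bar> * (inverse ?s * inverse ?t)"
      using pos by (simp add: abs_mult)
    also have "\<dots> \<le> \<bar>?t - ?s\<bar> * (1 * 1)"
      by (intro mult_left_mono mult_mono) (auto intro!: inverse_le_1_iff[THEN iffD2])
    also have "\<dots> \<le> \<bar>s - t\<bar>" by (auto simp: max_def)
    finally show ?thesis .
  qed
  have "k \<in> D"
    using lip by (intro D_lipschitz[OF BD_D[OF BD_mult[OF uBD uBD]]])
      (auto simp: k_def power2_eq_square)
  then have k: "k \<in> BD"
    by (rule BD_I[where C = 1]) (auto simp: k_def inverse_le_1_iff)
  have "g x = (g x * k x) * (u x * u x)" for x
  proof (cases "x \<in> carrier G \<and> \<bar>u x\<bar> \<ge> 1")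
    case True
    then have "(u x)\<^sup>2 \<ge> 1" using power_mono[of 1 "\<bar>u x\<bar>" 2] by simp
    then have "k x * (u x * u x) = 1"
      using True by (auto simp: k_def max_def power2_eq_square field_simps)
    then show ?thesis by (simp add: mult.assoc)
  next
    case False
    then have "g x = 0" using zero[of x] D_outside[OF BD_D[OF g], of x] by force
    then show ?thesis by simp
  qed
  then have "g = (\<lambda>x. (g x * k x) * (u x * u x))" by (rule ext)
  moreover have "(\<lambda>x. (g x * k x) * (u x * u x)) \<in> B0"
    by (intro B0_mult BD_mult g k u uBD)
  ultimately show ?thesis by metis
qed


lemma zero_B0: "(\<lambda>x. 0) \<in> B0"
  using BD_cst[of 0] by (auto simp: B0_iff const_fun_def finsupp_funs_def group_funs_def
      intro!: cl_superset D_zero)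

section \<open>Points of the harmonic boundary\<close>

text \<open>The neighbourhood filter of the harmonic boundary, traced on the group: convergence along
  it means that every element of \<open>B0\<close> becomes small. The threshold \<open>1\<close> stands for all positive
  thresholds because \<open>B0\<close> is stable under scaling.\<close>
definition boundary_filter :: "'a filter" where
  "boundary_filter = (INF u\<in>B0. principal {x \<in> carrier G. \<bar>u x\<bar> < 1})"

text \<open>The generating sets form a filter base: where \<open>u\<^sup>2 + v\<^sup>2 < 1\<close>, both \<open>u\<close> and \<open>v\<close> are
  below \<open>1\<close> in absolute value.\<close>
lemma eventually_boundary_filter:
  "eventually P boundary_filter \<longleftrightarrow> (\<exists>u\<in>B0. \<forall>x\<in>carrier G. \<bar>u x\<bar> < 1 \<longrightarrow> P x)"
proof -
  have "\<exists>w\<in>B0. principal {x \<in> carrier G. \<bar>w x\<bar> < 1}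
      \<le> inf (principal {x \<in> carrier G. \<bar>u x\<bar> < 1}) (principal {x \<in> carrier G. \<bar>v x\<bar> < 1})"
    if u: "u \<in> B0" and v: "v \<in> B0" for u v
  proof (rule bexI)
    let ?w = "\<lambda>x. u x * u x + v x * v x"
    show "?w \<in> B0" using u v B0_iff by (intro B0_add B0_mult) auto
    have "\<bar>a\<bar> < 1" if "a * a + b * b < 1" for a b :: real
    proof -
      have "\<bar>a\<bar>\<^sup>2 < 1" using that zero_le_square[of b] unfolding power2_abs power2_eq_square by linarith
      then show ?thesis using abs_square_less_1[of a] by simp
    qed
    then have "\<bar>u x\<bar> < 1 \<and> \<bar>v x\<bar> < 1" if "\<bar>?w x\<bar> < 1" for x
      using that by (metis abs_less_iff add.commute)
    then show "principal {x \<in> carrier G. \<bar>?w x\<bar> < 1}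
      \<le> inf (principal {x \<in> carrier G. \<bar>u x\<bar> < 1}) (principal {x \<in> carrier G. \<bar>v x\<bar> < 1})"
      unfolding inf_principal principal_le_iff by blast
  qed
  then show ?thesis
    unfolding boundary_filter_def
    by (subst eventually_INF_base) (use zero_B0 in \<open>auto simp: eventually_principal\<close>)
qed

lemma character_add:
  "\<tau> \<in> Sp_BDp G S p \<Longrightarrow> f \<in> BD \<Longrightarrow> g \<in> BD \<Longrightarrow> \<tau> (\<lambda>x. f x + g x) = \<tau> f + \<tau> g"
  by (simp add: Sp_BDp_def)

lemma character_one:
  assumes "\<tau> \<in> Sp_BDp G S p"
  shows "\<tau> (cst 1) = 1"
proof -
  obtain f where f: "f \<in> BD" "\<tau> f \<noteq> 0" using assms by (auto simp: Sp_BDp_def)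
  have "(\<lambda>x. f x * cst 1 x) = f" using D_outside[OF BD_D[OF f(1)]] by (auto simp: const_fun_def)
  moreover have "\<tau> (\<lambda>x. f x * cst 1 x) = \<tau> f * \<tau> (cst 1)"
    using assms f(1) BD_cst unfolding Sp_BDp_def by blast
  ultimately show ?thesis using f(2) by simp
qed

text \<open>An evaluation at a group element does not annihilate \<open>B0\<close>, because it takes the value \<open>1\<close>
  on the indicator function of that element.\<close>
lemma harmonic_boundaryI:
  assumes \<tau>: "\<tau> \<in> Sp_BDp G S p" and vanish: "\<And>u. u \<in> B0 \<Longrightarrow> \<tau> u = 0"
  shows "\<tau> \<in> harmonic_boundary G S p"
proof -
  have "\<tau> \<noteq> point_eval G S p x" if x: "x \<in> carrier G" for x
  proof
    assume eq: "\<tau> = point_eval G S p x"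
    let ?d = "\<lambda>y. if y = x then 1 else 0 :: real"
    have "?d \<in> finsupp_funs G" using x by (auto simp: finsupp_funs_def group_funs_def)
    then have "?d \<in> D0" "?d \<in> BD"
      by (auto intro!: cl_superset finsupp_D BD_I[where C = 1])
    then have "?d \<in> B0" by (simp add: B0_iff)
    then show False using vanish[of ?d] \<open>?d \<in> BD\<close> by (simp add: eq point_eval_def)
  qed
  then show ?thesis using assms by (auto simp: harmonic_boundary_def Rp_def)
qed

text \<open>The evaluations at group elements lie in a product of compact intervals, one for each
  bounded function, so by Tychonoff's theorem they have a cluster point along every proper
  filter. The equations that define an algebra homomorphism are closed conditions on
  coordinates, hence pass to the cluster point, and so do all closed conditions on the values
  of a function that hold eventually. The latter allow a boundary point to be
  steered away from a prescribed value.\<close>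
lemma exists_boundary_point:
  assumes le: "F \<le> boundary_filter" and nonbot: "F \<noteq> bot"
  obtains \<tau> t where "\<tau> \<in> harmonic_boundary G S p" "\<And>f. f \<in> BD \<Longrightarrow> \<tau> f = complex_of_real (t f)"
    "\<And>f C. f \<in> BD \<Longrightarrow> closed C \<Longrightarrow> eventually (\<lambda>x. f x \<in> C) F \<Longrightarrow> t f \<in> C"
proof -
  have "\<forall>f\<in>BD. \<exists>C. \<forall>x. \<bar>f x\<bar> \<le> C" using BD_bound by metis
  then obtain C where C: "\<And>f x. f \<in> BD \<Longrightarrow> \<bar>f x\<bar> \<le> C f" by metis
  define I where "I f = (if f \<in> BD then {- C f..C f} else {0})" for f
  define K where "K = PiE UNIV I"
  (* Coordinates outside BD carry no information; they are fixed at 0 to keep the product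
     compact. *)
  define ev where "ev x f = (if f \<in> BD then f x else 0)" for x :: 'a and f
  have "compactin (product_topology (\<lambda>_. euclideanreal) UNIV) K"
    unfolding K_def compactin_PiE by (simp add: I_def)
  then have "compact K" by (simp add: euclidean_product_topology)
  moreover have "ev x \<in> K" for x
    using C by (auto simp: K_def I_def ev_def abs_le_iff minus_le_iff)
  then have "eventually (\<lambda>\<sigma>. \<sigma> \<in> K) (filtermap ev F)" by (simp add: eventually_filtermap)
  moreover have "filtermap ev F \<noteq> bot" using nonbot by (simp add: filtermap_bot_iff)
  ultimately obtain t where t: "inf (nhds t) (filtermap ev F) \<noteq> bot"
    unfolding compact_filter by blast
  define H where "H = inf (nhds t) (filtermap ev F)"
  have H: "H \<noteq> bot" using t by (simp add: H_def)
  have coord: "((\<lambda>\<sigma>. \<sigma> f) \<longlongrightarrow> t f) H" for f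
  proof -
    have "continuous_on UNIV (\<lambda>\<sigma>. \<sigma> f :: real)" by simp
    then have "((\<lambda>\<sigma>. \<sigma> f) \<longlongrightarrow> t f) (at t)" by (simp add: continuous_on_def)
    then have "((\<lambda>\<sigma>. \<sigma> f) \<longlongrightarrow> t f) (nhds t)"
      by (rule iffD1[OF tendsto_at_iff_tendsto_nhds[of "\<lambda>\<sigma>. \<sigma> f" t]])
    then show ?thesis unfolding H_def by (rule tendsto_mono[OF inf_le1])
  qed
  have evH: "eventually P H" if "eventually (\<lambda>x. P (ev x)) F" for P
  proof -
    have "eventually P (filtermap ev F)" using that by (simp add: eventually_filtermap)
    then show ?thesis unfolding H_def by (rule filter_leD[OF inf_le2])
  qed
  have closed: "t f \<in> A" if "f \<in> BD" "closed A" "eventually (\<lambda>x. f x \<in> A) F" for f A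
    by (rule Lim_in_closed_set[OF that(2) _ H coord], rule evH) (use that in \<open>simp add: ev_def\<close>)
  have eq: "l = 0" if "(\<phi> \<longlongrightarrow> l) H" "\<And>x. \<phi> (ev x) = 0" for \<phi> and l :: real
  proof (rule tendsto_unique[OF H that(1)])
    show "(\<phi> \<longlongrightarrow> 0) H" by (rule tendsto_eventually, rule evH) (simp add: that(2))
  qed
  have add: "t (\<lambda>x. f x + g x) = t f + t g" if "f \<in> BD" "g \<in> BD" for f g
  proof -
    have "t (\<lambda>x. f x + g x) - (t f + t g) = 0"
      by (rule eq[where \<phi> = "\<lambda>\<sigma>. \<sigma> (\<lambda>x. f x + g x) - (\<sigma> f + \<sigma> g)"])
        (use that in \<open>auto intro!: tendsto_diff tendsto_add coord simp: ev_def BD_add\<close>)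
    then show ?thesis by simp
  qed
  have mult: "t (\<lambda>x. f x * g x) = t f * t g" if "f \<in> BD" "g \<in> BD" for f g
  proof -
    have "t (\<lambda>x. f x * g x) - t f * t g = 0"
      by (rule eq[where \<phi> = "\<lambda>\<sigma>. \<sigma> (\<lambda>x. f x * g x) - \<sigma> f * \<sigma> g"])
        (use that in \<open>auto intro!: tendsto_diff tendsto_mult coord simp: ev_def BD_mult\<close>)
    then show ?thesis by simp
  qed
  have cmult: "t (\<lambda>x. c * f x) = c * t f" if "f \<in> BD" for c f
  proof -
    have "t (\<lambda>x. c * f x) - c * t f = 0"
      by (rule eq[where \<phi> = "\<lambda>\<sigma>. \<sigma> (\<lambda>x. c * f x) - c * \<sigma> f"])
        (use that in \<open>auto intro!: tendsto_diff tendsto_mult tendsto_const coord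
           simp: ev_def BD_cmult\<close>)
    then show ?thesis by simp
  qed
  have small: "eventually (\<lambda>x. x \<in> carrier G \<and> \<bar>u x\<bar> < 1) F" if "u \<in> B0" for u
  proof (rule filter_leD[OF le])
    have "boundary_filter \<le> principal {x \<in> carrier G. \<bar>u x\<bar> < 1}"
      unfolding boundary_filter_def by (rule INF_lower[OF that])
    then show "eventually (\<lambda>x. x \<in> carrier G \<and> \<bar>u x\<bar> < 1) boundary_filter"
      by (simp add: le_principal)
  qed
  have one: "t (cst 1) = 1"
    using closed[OF BD_cst, of "{1}" 1] small[OF zero_B0] by (simp add: const_fun_def)
  have vanish: "t u = 0" if u: "u \<in> B0" for u
  proof -
    have "\<bar>t u\<bar> \<le> \<epsilon>" if "\<epsilon> > 0" for \<epsilon>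
    proof -
      have "(\<lambda>x. inverse \<epsilon> * u x) \<in> B0" using u by (simp add: B0_iff D0_cmult BD_cmult)
      then have "eventually (\<lambda>x. \<bar>inverse \<epsilon> * u x\<bar> < 1) F"
        using small eventually_mono by fastforce
      then have "eventually (\<lambda>x. u x \<in> {-\<epsilon>..\<epsilon>}) F"
        by (rule eventually_mono) (use that in \<open>auto simp: abs_mult field_simps abs_less_iff\<close>)
      then have "t u \<in> {-\<epsilon>..\<epsilon>}" using u by (intro closed) (auto simp: B0_iff)
      then show ?thesis by auto
    qed
    then show ?thesis using field_le_epsilon[of "\<bar>t u\<bar>" 0] by simp
  qed
  define \<tau> where "\<tau> = (\<lambda>f\<in>BD. complex_of_real (t f))"
  have "\<tau> \<in> Sp_BDp G S p"
    unfolding Sp_BDp_def \<tau>_def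
    using one BD_cst
    by (auto simp: BD_add BD_mult BD_cmult add mult cmult intro!: bexI[of _ "cst 1"])
  then have "\<tau> \<in> harmonic_boundary G S p"
    by (rule harmonic_boundaryI) (simp add: \<tau>_def vanish B0_iff)
  then show thesis using that[of \<tau> t] closed by (simp add: \<tau>_def)
qed

section \<open>Reduced cohomology and the boundary\<close>

abbreviation "ellp_closure \<equiv> cl (ellp_plus_const G p)"

lemma zero_ellp_closure: "(\<lambda>x. 0) \<in> ellp_closure"
  by (rule cl_superset[OF _ D_zero])
    (auto simp: ellp_plus_const_def ellp_def group_funs_def const_fun_def intro!: exI[of _ "\<lambda>x. 0"] exI[of _ 0])

text \<open>That \<open>f\<close> lies in the closed subspace is read off from the classes of \<open>0\<close> and \<open>- f\<close>, whose
  difference \<open>0 - (- f)\<close> is \<open>f\<close>.\<close>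
lemma reduced_H1_trivial_iff: "reduced_H1 G S p = {reduced_H1_zero G S p} \<longleftrightarrow> D \<subseteq> ellp_closure"
proof
  assume triv: "reduced_H1 G S p = {reduced_H1_zero G S p}"
  show "D \<subseteq> ellp_closure"
  proof
    fix f assume f: "f \<in> D"
    let ?g = "\<lambda>x. - f x"
    have g: "?g \<in> D" using f by (rule D_uminus)
    then have "H1_rel G S p `` {?g} \<in> reduced_H1 G S p" by (auto simp: reduced_H1_def quotient_def)
    then have "H1_rel G S p `` {?g} = H1_rel G S p `` {\<lambda>x. 0}"
      using triv by (simp add: reduced_H1_zero_def)
    moreover have "(?g, ?g) \<in> H1_rel G S p" using g zero_ellp_closure by (simp add: H1_rel_def)
    ultimately have "(\<lambda>x. 0, ?g) \<in> H1_rel G S p" by blast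
    then show "f \<in> ellp_closure" by (simp add: H1_rel_def)
  qed
next
  assume sub: "D \<subseteq> ellp_closure"
  have "H1_rel G S p `` {f} = D" if "f \<in> D" for f
    using that sub D_diff[OF that] by (auto simp: H1_rel_def)
  then show "reduced_H1 G S p = {reduced_H1_zero G S p}"
    using D_zero by (auto simp: reduced_H1_def reduced_H1_zero_def quotient_def)
qed

text \<open>Finitely supported functions are \<open>p\<close>-summable, so approximants of \<open>f - c\<close> give, after
  adding \<open>c\<close>, approximants of \<open>f\<close>.\<close>
lemma D0_plus_cst:
  assumes "(\<lambda>x. f x - cst c x) \<in> D0"
  shows "f \<in> ellp_closure"
proof -
  obtain g where g: "\<And>n. g n \<in> finsupp_funs G" "\<And>n. g n \<in> D"
      "(\<lambda>n. energy (\<lambda>x. (f x - cst c x) - g n x)) \<longlonglongrightarrow> 0"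
    using cl_sequence[OF assms] by blast
  have "f \<in> D" using D_add[OF cl_D[OF assms] D_cst[of c]] by simp
  then show ?thesis
  proof (rule clI[where g = "\<lambda>n x. g n x + cst c x"])
    show "(\<lambda>x. g n x + cst c x) \<in> ellp_plus_const G p" for n
    proof -
      let ?F = "{x \<in> carrier G. g n x \<noteq> 0}"
      have "(\<lambda>x. \<bar>g n x\<bar> powr p) summable_on ?F"
        using g(1)[of n] by (intro summable_on_finite) (simp add: finsupp_funs_def)
      then have "(\<lambda>x. \<bar>g n x\<bar> powr p) summable_on carrier G"
        by (subst summable_on_cong_neutral[where T = ?F]) auto
      then have "g n \<in> ellp G p" using g(1)[of n] by (simp add: ellp_def finsupp_funs_def)
      then show ?thesis by (auto simp: ellp_plus_const_def)
    qed
    show "(\<lambda>n. energy (\<lambda>x. f x - (g n x + cst c x))) \<longlonglongrightarrow> 0"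
      using g(3) by (simp add: algebra_simps)
  qed (use g in \<open>auto intro: D_add D_cst\<close>)
qed

text \<open>Truncation provides a bounded \<open>h\<close> outside the closed subspace. If the value
  \<open>t h\<close> at some boundary point were the only value of \<open>h\<close> on the boundary, then for each
  \<open>\<delta> > 0\<close> the function \<open>h\<close> would be \<open>\<delta>\<close>-close to \<open>t h\<close> wherever a suitable element of
  \<open>B0\<close> is small. The soft thresholding of \<open>h - t h\<close> at \<open>\<delta>\<close> would vanish there and so lie in
  \<open>B0\<close>; letting \<open>\<delta>\<close> tend to zero, \<open>h - t h\<close> would lie in \<open>D0\<close>.\<close>
lemma two_boundary_points:
  assumes "\<not> D \<subseteq> ellp_closure"
  shows "\<exists>\<tau>\<in>harmonic_boundary G S p. \<exists>\<tau>'\<in>harmonic_boundary G S p. \<tau> \<noteq> \<tau>'"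
proof (rule ccontr)
  assume unique: "\<not> ?thesis"
  obtain f where f: "f \<in> D" "f \<notin> ellp_closure" using assms by blast
  obtain n where n: "(\<lambda>x. clamp (real n) (f x)) \<notin> ellp_closure"
    using cl_closed[OF f(1) _ tendsto_clamp_large[OF f(1)]] f(2) by blast
  define h where "h x = clamp (real n) (f x)" for x
  have h: "h \<in> BD" "h \<notin> ellp_closure"
    unfolding h_def[abs_def] by (rule BD_clamp[OF f(1)], simp, rule n)
  have hD: "h \<in> D" using h BD_D by blast
  (* Otherwise 1 is in the ideal B0, which is then all of BD and contains h. *)
  have nonbot: "boundary_filter \<noteq> bot"
  proof
    assume "boundary_filter = bot"
    then obtain u where u: "u \<in> B0" "\<forall>x\<in>carrier G. \<not> \<bar>u x\<bar> < 1"
      using eventually_boundary_filter[of "\<lambda>x. False"] by auto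
    then have "h \<in> B0" by (intro B0_of_vanishing[OF h(1) u(1)]) auto
    then have "(\<lambda>x. h x - cst 0 x) \<in> D0" by (simp add: B0_iff const_fun_def)
    then show False using D0_plus_cst h(2) by blast
  qed
  obtain \<tau> t where \<tau>: "\<tau> \<in> harmonic_boundary G S p" "\<And>f. f \<in> BD \<Longrightarrow> \<tau> f = complex_of_real (t f)"
    using exists_boundary_point[OF order_refl nonbot] by metis
  define k where "k x = h x - cst (t h) x" for x
  have k: "k \<in> BD" unfolding k_def by (intro BD_diff h BD_cst)
  have "(\<lambda>x. k x - clamp \<delta> (k x)) \<in> B0" if \<delta>: "\<delta> > 0" for \<delta>
  proof -
    let ?F = "inf boundary_filter (principal {x. \<bar>k x\<bar> \<ge> \<delta>})"
    have "?F = bot"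
    proof (rule ccontr)
      assume "?F \<noteq> bot"
      then obtain \<tau>' t' where \<tau>': "\<tau>' \<in> harmonic_boundary G S p"
          "\<And>f. f \<in> BD \<Longrightarrow> \<tau>' f = complex_of_real (t' f)"
          "\<And>f C. f \<in> BD \<Longrightarrow> closed C \<Longrightarrow> eventually (\<lambda>x. f x \<in> C) ?F \<Longrightarrow> t' f \<in> C"
        using exists_boundary_point[OF inf_le1] by metis
      have "eventually (\<lambda>x. x \<in> carrier G) boundary_filter"
        unfolding eventually_boundary_filter using zero_B0 by blast
      then have "eventually (\<lambda>x. h x \<in> {y. \<bar>y - t h\<bar> \<ge> \<delta>}) ?F"
        unfolding eventually_inf_principal
        by (rule eventually_mono) (auto simp: k_def const_fun_def)
      moreover have "closed {y. \<bar>y - t h\<bar> \<ge> \<delta>}"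
        by (intro closed_Collect_le continuous_intros)
      ultimately have "t' h \<in> {y. \<bar>y - t h\<bar> \<ge> \<delta>}" using \<tau>'(3)[OF h(1)] by blast
      then have "t' h \<noteq> t h" using \<delta> by auto
      then have "\<tau>' h \<noteq> \<tau> h" using \<tau>(2) \<tau>'(2) h(1) by simp
      then have "\<tau> \<noteq> \<tau>'" by auto
      then show False using unique \<tau>(1) \<tau>'(1) by blast
    qed
    then have "eventually (\<lambda>x. False) ?F" by simp
    then have "eventually (\<lambda>x. \<not> \<bar>k x\<bar> \<ge> \<delta>) boundary_filter"
      by (simp add: eventually_inf_principal)
    then obtain u where u: "u \<in> B0" "\<forall>x\<in>carrier G. \<bar>u x\<bar> < 1 \<longrightarrow> \<not> \<bar>k x\<bar> \<ge> \<delta>"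
      unfolding eventually_boundary_filter by blast
    show ?thesis
    proof (rule B0_of_vanishing[OF _ u(1)])
      show "(\<lambda>x. k x - clamp \<delta> (k x)) \<in> BD"
        using \<delta> by (intro BD_diff k BD_clamp BD_D) auto
      show "k x - clamp \<delta> (k x) = 0" if "x \<in> carrier G" "\<bar>u x\<bar> < 1" for x
        using u(2) that clamp_id[of "k x" \<delta>] by force
    qed
  qed
  then have B0: "(\<lambda>x. k x - clamp (inverse (real (Suc n))) (k x)) \<in> B0" for n by simp
  have "k \<in> D0"
  proof (rule cl_closed[OF BD_D[OF k]])
    show "(\<lambda>x. k x - clamp (inverse (real (Suc n))) (k x)) \<in> D0" for n
      using B0[of n] by (simp only: B0_iff)
    show "(\<lambda>n. energy (\<lambda>x. k x - (k x - clamp (inverse (real (Suc n))) (k x)))) \<longlonglongrightarrow> 0"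
      using tendsto_clamp_small[OF BD_D[OF k]] by simp
  qed
  then show False using D0_plus_cst[of h "t h"] h(2) unfolding k_def by blast
qed

text \<open>If \<open>1\<close> has positive distance from \<open>D0\<close>, then the constants \<open>c n\<close> in an approximation of
  \<open>f\<close> by functions \<open>g n + c n\<close> form a Cauchy sequence, because \<open>c m - c n\<close> is close to
  \<open>g n - g m\<close> in \<open>D0\<close>. In other words, the sum of the closed subspace \<open>D0\<close> and the line of
  constants is closed.\<close>
lemma constant_modulo_D0:
  assumes one: "cst 1 \<notin> D0" and f: "f \<in> ellp_closure"
  shows "\<exists>c. (\<lambda>x. f x - cst c x) \<in> D0"
proof -
  (* eta is the p-th power of a lower bound for the distance from 1 to D0; by homogeneity, the
     constant c has distance at least |c| times as large. *)
  obtain \<eta> where \<eta>: "\<eta> > 0" "\<And>g. g \<in> D0 \<Longrightarrow> energy (\<lambda>x. cst 1 x - g x) \<ge> \<eta>"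
  proof -
    have "\<exists>\<eta>>0. \<forall>g\<in>D0. energy (\<lambda>x. cst 1 x - g x) \<ge> \<eta>"
    proof (rule ccontr)
      assume "\<not> ?thesis"
      then have "\<forall>n. \<exists>g\<in>D0. energy (\<lambda>x. cst 1 x - g x) < inverse (real (Suc n))"
        by (metis inverse_positive_iff_positive of_nat_0_less_iff zero_less_Suc not_le)
      then obtain g where g: "\<And>n. g n \<in> D0"
          "\<And>n. energy (\<lambda>x. cst 1 x - g n x) < inverse (real (Suc n))"
        by metis
      have "(\<lambda>n. energy (\<lambda>x. cst 1 x - g n x)) \<longlonglongrightarrow> 0"
        by (rule tendsto_sandwich[OF _ _ tendsto_const LIMSEQ_inverse_real_of_nat])
          (use g(2) in \<open>auto simp: energy_nonneg less_imp_le\<close>)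
      then have "cst 1 \<in> D0" by (rule cl_closed[where g = g, OF D_cst g(1)])
      then show False using one by contradiction
    qed
    then show ?thesis using that by blast
  qed
  have dist: "\<bar>c\<bar> powr p * \<eta> \<le> energy (\<lambda>x. cst c x - g x)" if g: "g \<in> D0" for c g
  proof (cases "c = 0")
    case False
    have "energy (\<lambda>x. cst c x - g x) = energy (\<lambda>x. c * (cst 1 x - inverse c * g x))"
      using False by (intro arg_cong[where f = energy] ext) (simp add: const_fun_def field_simps)
    also have "\<dots> = \<bar>c\<bar> powr p * energy (\<lambda>x. cst 1 x - inverse c * g x)" by (rule energy_cmult)
    also have "\<dots> \<ge> \<bar>c\<bar> powr p * \<eta>" by (intro mult_left_mono \<eta> D0_cmult g) auto
    finally show ?thesis .
  qed (simp add: energy_nonneg)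
  obtain q where q: "\<And>n. q n \<in> ellp_plus_const G p" "\<And>n. q n \<in> D"
      "(\<lambda>n. energy (\<lambda>x. f x - q n x)) \<longlonglongrightarrow> 0"
    using cl_sequence[OF f] by blast
  have "\<forall>n. \<exists>g c. g \<in> ellp G p \<and> q n = (\<lambda>x. g x + cst c x)"
    using q(1) unfolding ellp_plus_const_def by blast
  then obtain g c where gc: "\<And>n. g n \<in> ellp G p" "\<And>n. q n = (\<lambda>x. g n x + cst (c n) x)" by metis
  have gD0: "g n \<in> D0" for n
    using D_diff[OF q(2)[of n] D_cst[of "c n"]] gc by (intro ellp_subset_D0) simp_all
  have fD: "f \<in> D" using f by (rule cl_D)
  let ?e = "\<lambda>n. energy (\<lambda>x. f x - q n x)"
  have close: "\<bar>c m - c n\<bar> powr p * \<eta> \<le> 2 powr p * (?e n + ?e m)" for m n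
  proof -
    have "(\<lambda>x. g n x - g m x) \<in> D0"
      using D0_add[OF gD0[of n] D0_cmult[OF gD0[of m], of "-1"]] by simp
    then have "\<bar>c m - c n\<bar> powr p * \<eta> \<le> energy (\<lambda>x. cst (c m - c n) x - (g n x - g m x))"
      by (rule dist)
    also have "\<dots> = energy (\<lambda>x. (f x - q n x) + (q m x - f x))"
      by (intro arg_cong[where f = energy] ext) (simp add: gc(2) const_fun_def)
    also have "\<dots> \<le> 2 powr p * (?e n + energy (\<lambda>x. q m x - f x))"
      by (intro energy_add_le D_diff fD q)
    finally show ?thesis by (simp add: energy_minus_commute[of "q m" f])
  qed
  have "Cauchy c"
  proof (rule metric_CauchyI)
    fix e :: real assume e: "e > 0"
    (* With both energies below d, the right-hand side of the fact close drops below
       e powr p * eta. *)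
    define d where "d = e powr p * \<eta> / (2 powr p * 2)"
    have d: "d > 0" using e \<eta> by (simp add: d_def)
    obtain N where N: "\<And>n. n \<ge> N \<Longrightarrow> ?e n < d"
      using order_tendstoD(2)[OF q(3) d] unfolding eventually_sequentially by blast
    have "dist (c m) (c n) < e" if "m \<ge> N" "n \<ge> N" for m n
    proof (rule ccontr)
      assume "\<not> dist (c m) (c n) < e"
      then have "e powr p * \<eta> \<le> \<bar>c m - c n\<bar> powr p * \<eta>"
        using e \<eta> by (intro mult_right_mono powr_mono2) (auto simp: dist_real_def)
      also have "\<dots> \<le> 2 powr p * (?e n + ?e m)" by (rule close)
      also have "\<dots> < 2 powr p * (d + d)" using N that by (intro mult_strict_left_mono add_strict_mono) auto
      also have "\<dots> = e powr p * \<eta>" by (simp add: d_def)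
      finally show False by simp
    qed
    then show "\<exists>M. \<forall>m\<ge>M. \<forall>n\<ge>M. dist (c m) (c n) < e" by blast
  qed
  then obtain b where b: "c \<longlonglongrightarrow> b" using Cauchy_convergent_iff convergent_def by blast
  have "(\<lambda>n. c n - b) \<longlonglongrightarrow> 0" using b by (simp add: LIM_zero)
  then have "(\<lambda>n. energy (cst (c n - b))) \<longlonglongrightarrow> 0"
    unfolding energy_cst by (rule tendsto_powr_zero) simp
  then have "(\<lambda>n. energy (\<lambda>x. (f x - q n x) + cst (c n - b) x)) \<longlonglongrightarrow> 0"
    by (intro tendsto_energy_sum[OF _ _ q(3)]) (auto intro: D_diff fD q D_cst)
  moreover have "(f x - q n x) + cst (c n - b) x = (f x - cst b x) - g n x" for n x
    by (simp add: gc(2) const_fun_def)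
  ultimately have "(\<lambda>n. energy (\<lambda>x. (f x - cst b x) - g n x)) \<longlonglongrightarrow> 0" by simp
  then have "(\<lambda>x. f x - cst b x) \<in> D0"
    by (rule cl_closed[where g = g, OF D_diff[OF fD D_cst] gD0])
  then show ?thesis by blast
qed

text \<open>A boundary point annihilates \<open>B0\<close> but not \<open>1\<close>, hence \<open>1\<close> is not in \<open>D0\<close>, and every bounded
  function of finite energy is a constant modulo \<open>B0\<close> (\<open>constant_modulo_D0\<close>). That constant is its value at each boundary point.\<close>
lemma boundary_point_unique:
  assumes sub: "D \<subseteq> ellp_closure"
    and \<tau>: "\<tau> \<in> harmonic_boundary G S p" and \<tau>': "\<tau>' \<in> harmonic_boundary G S p"
  shows "\<tau> = \<tau>'"
proof -
  have Sp: "\<sigma> \<in> Sp_BDp G S p" and vanish: "\<And>u. u \<in> B0 \<Longrightarrow> \<sigma> u = 0"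
    if "\<sigma> \<in> harmonic_boundary G S p" for \<sigma>
    using that by (auto simp: harmonic_boundary_def Rp_def)
  have "cst 1 \<notin> B0" using vanish[OF \<tau>, of "cst 1"] character_one[OF Sp[OF \<tau>]] by auto
  then have one: "cst 1 \<notin> D0" using BD_cst by (simp add: B0_iff)
  have determined: "\<exists>c. \<forall>\<sigma>\<in>harmonic_boundary G S p. \<sigma> f = c" if f: "f \<in> BD" for f
  proof -
    obtain c where c: "(\<lambda>x. f x - cst c x) \<in> D0"
      using constant_modulo_D0[OF one] sub BD_D[OF f] by blast
    let ?g = "\<lambda>x. f x - cst c x"
    have g: "?g \<in> B0" using c BD_diff[OF f BD_cst] by (simp add: B0_iff)
    have "\<sigma> f = complex_of_real c" if \<sigma>: "\<sigma> \<in> harmonic_boundary G S p" for \<sigma>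
    proof -
      have "\<sigma> (\<lambda>x. ?g x + c * cst 1 x) = \<sigma> ?g + \<sigma> (\<lambda>x. c * cst 1 x)"
        using g by (intro character_add[OF Sp[OF \<sigma>]] BD_cmult BD_cst) (simp add: B0_iff)
      also have "\<sigma> (\<lambda>x. c * cst 1 x) = complex_of_real c * \<sigma> (cst 1)"
        using Sp[OF \<sigma>] BD_cst unfolding Sp_BDp_def by blast
      also have "(\<lambda>x. ?g x + c * cst 1 x) = f" by (auto simp: const_fun_def)
      finally show ?thesis using vanish[OF \<sigma> g] character_one[OF Sp[OF \<sigma>]] by simp
    qed
    then show ?thesis by blast
  qed
  show ?thesis
  proof (rule extensionalityI)
    show "\<tau> \<in> extensional BD" "\<tau>' \<in> extensional BD"
      using Sp \<tau> \<tau>' by (auto simp: Sp_BDp_def)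
    show "\<tau> f = \<tau>' f" if "f \<in> BD" for f using determined[OF that] \<tau> \<tau>' by metis
  qed
qed

end

theorem theorem2p10:
  fixes G :: "('a, 'b) monoid_scheme" and S :: "'a set" and p :: real
  assumes "p > 1"
    and "group G"
    and "infinite (carrier G)"
    and "finite S" and "S \<subseteq> carrier G" and "generate G S = carrier G"
  shows "reduced_H1 G S p \<noteq> {reduced_H1_zero G S p} \<longleftrightarrow>
    infinite (harmonic_boundary G S p) \<or> card (harmonic_boundary G S p) > 1"
proof -
  interpret group G by fact
  interpret cayley_graph G S p by unfold_locales (use assms in auto)
  let ?A = "harmonic_boundary G S p"
  have more_than_one: "infinite ?A \<or> card ?A > 1 \<longleftrightarrow> (\<exists>a\<in>?A. \<exists>b\<in>?A. a \<noteq> b)"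
  proof (cases "finite ?A")
    case True
    then show ?thesis using card_le_Suc0_iff_eq[of ?A] by (auto simp: not_le[symmetric])
  next
    case False
    then obtain a where "a \<in> ?A" using infinite_imp_nonempty by blast
    moreover have "?A - {a} \<noteq> {}" using False infinite_remove infinite_imp_nonempty by metis
    ultimately show ?thesis using False by blast
  qed
  show ?thesis
    unfolding more_than_one reduced_H1_trivial_iff
    using two_boundary_points boundary_point_unique by blast
qed

end
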